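(* Let $X$ be a topological vector space which has no quotients isomorphic to $\varphi$. Then there is no cyclic operator $T\in L(X\times\varphi)$ with dense range.
   Context: Conventions: $\mathbb K$ is $\mathbb R$ or $\mathbb C$; all vector spaces are non-zero and over $\mathbb K$; all topological spaces are Hausdorff; $\mathbb Z_+=\{0,1,2,\dots\}$. $L(X)$ is the space of continuous linear operators on $X$. Isomorphic means linearly homeomorphic. A quotient of a topological vector space $X$ is a space $X/Y$ with $Y$ a closed linear subspace of $X$. $\varphi$ is the locally convex direct sum of countably many copies of $\mathbb K$, i.e. a vector space of countably infinite algebraic dimension with the strongest locally convex topology. $T\in L(Z)$ is cyclic if the linear span of $\{T^nz:n\in\mathbb Z_+\}$ is dense in $Z$ for some $z\in Z$. *)

theory Defs
  imports "HOL-Analysis.Analysis" "HOL-Library.Poly_Mapping"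
begin

text \<open>
  The ground field is a type of sort \<open>{real_normed_field, euclidean_space}\<close>. Its instances are
  exactly the real and the complex numbers: a finite-dimensional commutative real division
  algebra is isomorphic to one of them, and the multiplicative norm is then the usual absolute
  value. A vector space is a type of class \<open>ab_group_add\<close> with an explicit scalar multiplication,
  so that real and complex spaces are treated uniformly.
\<close>

section \<open>Topological vector spaces\<close>

text \<open>All topological vector spaces are Hausdorff.\<close>

definition tvs :: "('k::real_normed_field \<Rightarrow> 'a::ab_group_add \<Rightarrow> 'a) \<Rightarrow> 'a topology \<Rightarrow> bool" where
  "tvs smul T \<longleftrightarrow>
     vector_space smul \<and> topspace T = UNIV \<and> Hausdorff_space T \<and>
     continuous_map (prod_topology T T) T (\<lambda>(x, y). x + y) \<and>
     continuous_map (prod_topology euclidean T) T (\<lambda>(c, x). smul c x)"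

definition convex_wrt :: "('k::real_normed_field \<Rightarrow> 'a::ab_group_add \<Rightarrow> 'a) \<Rightarrow> 'a set \<Rightarrow> bool" where
  "convex_wrt smul C \<longleftrightarrow>
     (\<forall>x\<in>C. \<forall>y\<in>C. \<forall>u\<ge>0. \<forall>v\<ge>0. u + v = 1 \<longrightarrow>
        smul (of_real u) x + smul (of_real v) y \<in> C)"

definition locally_convex_tvs ::
    "('k::real_normed_field \<Rightarrow> 'a::ab_group_add \<Rightarrow> 'a) \<Rightarrow> 'a topology \<Rightarrow> bool" where
  "locally_convex_tvs smul T \<longleftrightarrow>
     tvs smul T \<and>
     (\<forall>U. openin T U \<and> 0 \<in> U \<longrightarrow>
        (\<exists>C V. convex_wrt smul C \<and> openin T V \<and> 0 \<in> V \<and> V \<subseteq> C \<and> C \<subseteq> U))"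

text \<open>The join of all locally convex vector space topologies; whenever there is at least one of
  them, it is again locally convex and hence the strongest one (see below).\<close>

definition strongest_lc_topology ::
    "('k::real_normed_field \<Rightarrow> 'a::ab_group_add \<Rightarrow> 'a) \<Rightarrow> 'a topology" where
  "strongest_lc_topology smul =
     topology_generated_by {U. \<exists>T. locally_convex_tvs smul T \<and> openin T U}"

definition continuous_operator ::
    "('k::real_normed_field \<Rightarrow> 'a::ab_group_add \<Rightarrow> 'a) \<Rightarrow> 'a topology \<Rightarrow> ('a \<Rightarrow> 'a) \<Rightarrow> bool" where
  "continuous_operator smul T A \<longleftrightarrow>
     Vector_Spaces.linear smul smul A \<and> continuous_map T T A"

definition dense_in :: "'a topology \<Rightarrow> 'a set \<Rightarrow> bool" where
  "dense_in T S \<longleftrightarrow> T closure_of S = topspace T"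

definition cyclic_operator ::
    "('k::real_normed_field \<Rightarrow> 'a::ab_group_add \<Rightarrow> 'a) \<Rightarrow> 'a topology \<Rightarrow> ('a \<Rightarrow> 'a) \<Rightarrow> bool" where
  "cyclic_operator smul T A \<longleftrightarrow>
     (\<exists>z. dense_in T (module.span smul (range (\<lambda>n::nat. (A ^^ n) z))))"

definition prod_scale ::
    "('k \<Rightarrow> 'a \<Rightarrow> 'a) \<Rightarrow> ('k \<Rightarrow> 'b \<Rightarrow> 'b) \<Rightarrow> 'k \<Rightarrow> 'a \<times> 'b \<Rightarrow> 'a \<times> 'b" where
  "prod_scale s1 s2 c = map_prod (s1 c) (s2 c)"


section \<open>The space \<open>\<phi>\<close>\<close>

text \<open>The underlying vector space is \<open>nat \<Rightarrow>\<^sub>0 'k\<close>, the finitely supported sequences, i.e. the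
  algebraic direct sum of countably many copies of the ground field.\<close>

definition phi_scale :: "'k::real_normed_field \<Rightarrow> (nat \<Rightarrow>\<^sub>0 'k) \<Rightarrow> (nat \<Rightarrow>\<^sub>0 'k)" where
  "phi_scale c = Poly_Mapping.map ((*) c)"

definition phi_topology :: "(nat \<Rightarrow>\<^sub>0 'k::real_normed_field) topology" where
  "phi_topology = strongest_lc_topology phi_scale"


section \<open>Quotients\<close>

text \<open>The elements of \<open>X/Y\<close> are the cosets of \<open>Y\<close>. The type of all sets carries no suitable group
  structure, so the vector space operations of \<open>X/Y\<close> are given explicitly.\<close>

definition coset_of :: "'a::ab_group_add set \<Rightarrow> 'a \<Rightarrow> 'a set" where
  "coset_of Y x = (\<lambda>y. x + y) ` Y"

definition quotient_add :: "'a::ab_group_add set \<Rightarrow> 'a set \<Rightarrow> 'a set" where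
  "quotient_add A B = {a + b | a b. a \<in> A \<and> b \<in> B}"

text \<open>The summand \<open>Y\<close> only matters for \<open>c = 0\<close>, where the result has to be the coset \<open>Y\<close>.\<close>

definition quotient_scale ::
    "('k \<Rightarrow> 'a::ab_group_add \<Rightarrow> 'a) \<Rightarrow> 'a set \<Rightarrow> 'k \<Rightarrow> 'a set \<Rightarrow> 'a set" where
  "quotient_scale smul Y c A = {smul c a + y | a y. a \<in> A \<and> y \<in> Y}"

definition quotient_topology :: "'a::ab_group_add topology \<Rightarrow> 'a set \<Rightarrow> 'a set topology" where
  "quotient_topology T Y =
     topology (\<lambda>U. U \<subseteq> coset_of Y ` topspace T \<and> openin T {x \<in> topspace T. coset_of Y x \<in> U})"

definition quotient_isomorphic ::
    "('k \<Rightarrow> 'a::ab_group_add \<Rightarrow> 'a) \<Rightarrow> 'a topology \<Rightarrow> 'a set \<Rightarrow>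
     ('k \<Rightarrow> 'b::ab_group_add \<Rightarrow> 'b) \<Rightarrow> 'b topology \<Rightarrow> bool" where
  "quotient_isomorphic smul T Y smul' T' \<longleftrightarrow>
     (\<exists>f. homeomorphic_map (quotient_topology T Y) T' f \<and>
          (\<forall>A \<in> range (coset_of Y). \<forall>B \<in> range (coset_of Y).
             f (quotient_add A B) = f A + f B) \<and>
          (\<forall>c. \<forall>A \<in> range (coset_of Y).
             f (quotient_scale smul Y c A) = smul' c (f A)))"

definition has_quotient_isomorphic ::
    "('k::real_normed_field \<Rightarrow> 'a::ab_group_add \<Rightarrow> 'a) \<Rightarrow> 'a topology \<Rightarrow>
     ('k \<Rightarrow> 'b::ab_group_add \<Rightarrow> 'b) \<Rightarrow> 'b topology \<Rightarrow> bool" where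
  "has_quotient_isomorphic smul T smul' T' \<longleftrightarrow>
     (\<exists>Y. module.subspace smul Y \<and> closedin T Y \<and> quotient_isomorphic smul T Y smul' T')"


section \<open>The definitions behave as intended\<close>

lemma openin_quotient_topology:
  "openin (quotient_topology T Y) U \<longleftrightarrow>
     U \<subseteq> coset_of Y ` topspace T \<and> openin T {x \<in> topspace T. coset_of Y x \<in> U}"
proof -
  let ?P = "\<lambda>U. U \<subseteq> coset_of Y ` topspace T \<and> openin T {x \<in> topspace T. coset_of Y x \<in> U}"
  have int: "?P (S \<inter> S')" if "?P S" "?P S'" for S S'
  proof -
    have "{x \<in> topspace T. coset_of Y x \<in> S \<inter> S'} =
      {x \<in> topspace T. coset_of Y x \<in> S} \<inter> {x \<in> topspace T. coset_of Y x \<in> S'}" by auto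
    with that show ?thesis by auto
  qed
  have un: "?P (\<Union>\<K>)" if "\<forall>K\<in>\<K>. ?P K" for \<K>
  proof -
    have "{x \<in> topspace T. coset_of Y x \<in> \<Union>\<K>} =
      (\<Union>K\<in>\<K>. {x \<in> topspace T. coset_of Y x \<in> K})" by auto
    with that show ?thesis by auto
  qed
  have "istopology ?P" unfolding istopology_def using int un by meson
  from topology_inverse'[OF this] show ?thesis by (simp add: quotient_topology_def)
qed

lemma quotient_map_coset_of: "quotient_map T (quotient_topology T Y) (coset_of Y)"
proof -
  have "openin (quotient_topology T Y) (coset_of Y ` topspace T)"
  proof -
    have "{x \<in> topspace T. coset_of Y x \<in> coset_of Y ` topspace T} = topspace T" by blast
    then show ?thesis by (simp add: openin_quotient_topology)
  qed
  then have "topspace (quotient_topology T Y) = coset_of Y ` topspace T"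
    by (metis openin_quotient_topology openin_subset openin_topspace subset_antisym)
  then show ?thesis by (auto simp: quotient_map_def openin_quotient_topology)
qed

lemma quotient_operations:
  assumes "vector_space smul" "module.subspace smul Y"
  shows "quotient_add (coset_of Y x) (coset_of Y y) = coset_of Y (x + y)"
    and "quotient_scale smul Y c (coset_of Y x) = coset_of Y (smul c x)"
proof -
  interpret vector_space smul by fact
  have Y: "0 \<in> Y" "\<And>a b. a \<in> Y \<Longrightarrow> b \<in> Y \<Longrightarrow> a + b \<in> Y" "\<And>a k. a \<in> Y \<Longrightarrow> smul k a \<in> Y"
    using assms(2) by (auto simp: subspace_def)
  show "quotient_add (coset_of Y x) (coset_of Y y) = coset_of Y (x + y)"
    unfolding quotient_add_def coset_of_def
  proof (safe)
    fix a b assume "a \<in> Y" "b \<in> Y"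
    then show "x + a + (y + b) \<in> (+) (x + y) ` Y"
      by (intro image_eqI[of _ _ "a + b"]) (auto simp: Y algebra_simps)
  next
    fix a assume "a \<in> Y"
    then show "\<exists>u v. x + y + a = u + v \<and> u \<in> (+) x ` Y \<and> v \<in> (+) y ` Y"
      by (intro exI[of _ "x + 0"] exI[of _ "y + a"]) (use Y(1) in \<open>auto simp: algebra_simps\<close>)
  qed
  show "quotient_scale smul Y c (coset_of Y x) = coset_of Y (smul c x)"
    unfolding quotient_scale_def coset_of_def
  proof (safe)
    fix a b assume "a \<in> Y" "b \<in> Y"
    then show "smul c (x + a) + b \<in> (+) (smul c x) ` Y"
      by (intro image_eqI[of _ _ "smul c a + b"]) (auto simp: Y scale_right_distrib algebra_simps)
  next
    fix a assume "a \<in> Y"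
    then show "\<exists>u v. smul c x + a = smul c u + v \<and> u \<in> (+) x ` Y \<and> v \<in> Y"
      by (intro exI[of _ "x + 0"] exI[of _ a]) (use Y(1) in auto)
  qed
qed

lemma phi_scale_lookup: "Poly_Mapping.lookup (phi_scale c p) n = c * Poly_Mapping.lookup p n"
  by (simp add: phi_scale_def Poly_Mapping.map.rep_eq when_def)

lemma vector_space_phi: "vector_space phi_scale"
  by unfold_locales
    (auto intro!: poly_mapping_eqI simp: phi_scale_lookup lookup_add algebra_simps)

lemma vector_space_prod_scale:
  assumes "vector_space s1" "vector_space s2"
  shows "vector_space (prod_scale s1 s2)"
proof -
  interpret a: vector_space s1 by fact
  interpret b: vector_space s2 by fact
  show ?thesis
    by unfold_locales
      (auto simp: prod_scale_def a.scale_right_distrib b.scale_right_distrib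
        a.scale_left_distrib b.scale_left_distrib)
qed

lemma tvs_translation:
  assumes "tvs s T" "openin T U"
  shows "openin T {x. a + x \<in> U}"
proof -
  have T: "topspace T = UNIV" and c: "continuous_map (prod_topology T T) T (\<lambda>(x, y). x + y)"
    using assms(1) by (auto simp: tvs_def)
  have "continuous_map T (prod_topology T T) (\<lambda>x. (a, x))"
    by (intro continuous_intros) (auto simp: T)
  from continuous_map_compose[OF this c] have "continuous_map T T (\<lambda>x. a + x)"
    by (simp add: o_def)
  from openin_continuous_map_preimage[OF this assms(2)] show ?thesis by (simp add: T)
qed

text \<open>A topology generated by sets which contain a convex neighbourhood of each of their points has
  a base of convex neighbourhoods.\<close>

lemma generated_convex_base:
  assumes "\<And>W x. W \<in> B \<Longrightarrow> x \<in> W \<Longrightarrow>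
      \<exists>C V. convex_wrt s C \<and> openin (topology_generated_by B) V \<and> x \<in> V \<and> V \<subseteq> C \<and> C \<subseteq> W"
    and "openin (topology_generated_by B) U" "x \<in> U"
  shows "\<exists>C V. convex_wrt s C \<and> openin (topology_generated_by B) V \<and> x \<in> V \<and> V \<subseteq> C \<and> C \<subseteq> U"
proof -
  have "generate_topology_on B U" using assms(2) by (rule openin_topology_generated_by)
  then show ?thesis using assms(3)
  proof (induction)
    case (Int a b)
    then obtain C V C' V' where
      "convex_wrt s C" "openin (topology_generated_by B) V" "x \<in> V" "V \<subseteq> C" "C \<subseteq> a"
      "convex_wrt s C'" "openin (topology_generated_by B) V'" "x \<in> V'" "V' \<subseteq> C'" "C' \<subseteq> b"
      by (meson IntE)
    then show ?case
      by (intro exI[of _ "C \<inter> C'"] exI[of _ "V \<inter> V'"]) (auto simp: convex_wrt_def)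
  next
    case (UN K)
    then obtain k where "k \<in> K" "x \<in> k" by auto
    with UN show ?case by (meson Union_upper order_trans)
  qed (use assms(1) in auto)
qed

text \<open>If there is a (Hausdorff) locally convex topology at all, there is a strongest one, namely the
  join.\<close>

lemma openin_strongest_lc_topology:
  assumes "locally_convex_tvs s T" "openin T U"
  shows "openin (strongest_lc_topology s) U"
  unfolding strongest_lc_topology_def using assms by (intro topology_generated_by_Basis) blast

lemma strongest_lc_topology_locally_convex:
  assumes T0: "locally_convex_tvs s T0"
  shows "locally_convex_tvs s (strongest_lc_topology s)"
proof -
  define J where "J = strongest_lc_topology s"
  define B where "B = {U. \<exists>T. locally_convex_tvs s T \<and> openin T U}"
  have J: "J = topology_generated_by B"
    by (simp add: J_def strongest_lc_topology_def B_def)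
  have T0': "tvs s T0" using T0 by (simp add: locally_convex_tvs_def)
  have fine: "openin J U" if "locally_convex_tvs s T" "openin T U" for T U
    using openin_strongest_lc_topology[OF that] by (simp add: J_def)
  have top: "topspace J = UNIV"
    using fine[OF T0, of UNIV] T0' openin_subset[of J UNIV]
    by (metis openin_topspace top.extremum_uniqueI tvs_def)
  have idJ: "continuous_map J T (\<lambda>x. x)" if "locally_convex_tvs s T" for T
    using that fine[OF that]
    by (auto simp: continuous_map_def top locally_convex_tvs_def tvs_def)
  have BU: "\<Union>B = UNIV" using top by (simp add: J)
  have haus: "Hausdorff_space J"
    unfolding Hausdorff_space_def
    using T0' fine[OF T0] by (metis Hausdorff_space_def UNIV_I tvs_def)
  have add: "continuous_map (prod_topology J J) J (\<lambda>(x, y). x + y)"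
  proof -
    have "continuous_map (prod_topology J J) (topology_generated_by B) (\<lambda>(x, y). x + y)"
    proof (rule continuous_on_generated_topo)
      fix U assume "U \<in> B"
      then obtain T where T: "locally_convex_tvs s T" "openin T U" by (auto simp: B_def)
      have "continuous_map (prod_topology J J) (prod_topology T T) (\<lambda>z. (fst z, snd z))"
        by (intro continuous_map_pairedI
            continuous_map_compose[OF continuous_map_fst idJ[OF T(1)], unfolded o_def]
            continuous_map_compose[OF continuous_map_snd idJ[OF T(1)], unfolded o_def])
      moreover have "continuous_map (prod_topology T T) T (\<lambda>(x, y). x + y)"
        using T(1) by (simp add: locally_convex_tvs_def tvs_def)
      ultimately have "continuous_map (prod_topology J J) T ((\<lambda>(x, y). x + y) \<circ> (\<lambda>z. (fst z, snd z)))"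
        by (rule continuous_map_compose)
      then have "continuous_map (prod_topology J J) T (\<lambda>(x, y). x + y)"
        by (simp add: o_def case_prod_unfold)
      from openin_continuous_map_preimage[OF this T(2)]
      show "openin (prod_topology J J)
          ((\<lambda>(x, y). x + y) -` U \<inter> topspace (prod_topology J J))"
        by (simp add: top vimage_def)
    qed (simp add: BU)
    then show ?thesis by (simp add: J)
  qed
  have scl: "continuous_map (prod_topology euclidean J) J (\<lambda>(c, x). s c x)"
  proof -
    have "continuous_map (prod_topology euclidean J) (topology_generated_by B) (\<lambda>(c, x). s c x)"
    proof (rule continuous_on_generated_topo)
      fix U assume "U \<in> B"
      then obtain T where T: "locally_convex_tvs s T" "openin T U" by (auto simp: B_def)
      have "continuous_map (prod_topology euclidean J) (prod_topology euclidean T) (\<lambda>z. (fst z, snd z))"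
        by (intro continuous_map_pairedI continuous_map_fst
            continuous_map_compose[OF continuous_map_snd idJ[OF T(1)], unfolded o_def])
      moreover have "continuous_map (prod_topology euclidean T) T (\<lambda>(c, x). s c x)"
        using T(1) by (simp add: locally_convex_tvs_def tvs_def)
      ultimately have
        "continuous_map (prod_topology euclidean J) T ((\<lambda>(c, x). s c x) \<circ> (\<lambda>z. (fst z, snd z)))"
        by (rule continuous_map_compose)
      then have "continuous_map (prod_topology euclidean J) T (\<lambda>(c, x). s c x)"
        by (simp add: o_def case_prod_unfold)
      from openin_continuous_map_preimage[OF this T(2)]
      show "openin (prod_topology euclidean J)
          ((\<lambda>(c, x). s c x) -` U \<inter> topspace (prod_topology euclidean J))"
        by (simp add: top vimage_def)
    qed (simp add: BU)
    then show ?thesis by (simp add: J)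
  qed
  have tvsJ: "tvs s J" using T0' haus add scl top by (simp add: tvs_def)
  interpret vector_space s using T0' by (simp add: tvs_def)
  have base: "\<exists>C V. convex_wrt s C \<and> openin J V \<and> x \<in> V \<and> V \<subseteq> C \<and> C \<subseteq> W"
    if "W \<in> B" "x \<in> W" for W x
  proof -
    from that obtain T where T: "locally_convex_tvs s T" "openin T W" by (auto simp: B_def)
    have Tt: "tvs s T" using T by (simp add: locally_convex_tvs_def)
    have "openin T {y. x + y \<in> W}" by (rule tvs_translation[OF Tt T(2)])
    with T(1) that obtain C V where
      CV: "convex_wrt s C" "openin T V" "0 \<in> V" "V \<subseteq> C" "C \<subseteq> {y. x + y \<in> W}"
      unfolding locally_convex_tvs_def by fastforce
    have eq: "x + (s (of_real u) a + s (of_real v) b)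
        = s (of_real u) (x + a) + s (of_real v) (x + b)" if "u + v = 1" for u v a b
    proof -
      have "s (of_real u) x + s (of_real v) x = x"
        using that by (simp flip: scale_left_distrib of_real_add)
      then show ?thesis by (simp add: scale_right_distrib algebra_simps)
    qed
    have conv: "convex_wrt s ((+) x ` C)"
      using CV(1) unfolding convex_wrt_def by (auto simp flip: eq)
    have "openin T {y. - x + y \<in> V}" by (rule tvs_translation[OF Tt CV(2)])
    then have "openin J {y. - x + y \<in> V}" by (rule fine[OF T(1)])
    moreover have "{y. - x + y \<in> V} \<subseteq> (+) x ` C"
    proof
      fix y assume "y \<in> {y. - x + y \<in> V}"
      then have "- x + y \<in> C" using CV(4) by auto
      then show "y \<in> (+) x ` C" by (intro image_eqI[of _ _ "- x + y"]) auto
    qed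
    ultimately show ?thesis
      using conv CV(3,5) by (intro exI[of _ "(+) x ` C"] exI[of _ "{y. - x + y \<in> V}"]) auto
  qed
  have "\<exists>C V. convex_wrt s C \<and> openin J V \<and> 0 \<in> V \<and> V \<subseteq> C \<and> C \<subseteq> U"
    if "openin J U" "0 \<in> U" for U
    using generated_convex_base[of B s U 0] base that unfolding J by blast
  with tvsJ show ?thesis by (auto simp: locally_convex_tvs_def J_def)
qed

text \<open>On \<open>\<phi>\<close> the topology of coordinatewise convergence is locally convex, so the above applies.\<close>

definition phi_coordinate_topology :: "(nat \<Rightarrow>\<^sub>0 'k::real_normed_field) topology" where
  "phi_coordinate_topology =
     topology_generated_by {{p. Poly_Mapping.lookup p n \<in> U} | n U. open U}"

lemma phi_coordinate_locally_convex:
  "locally_convex_tvs phi_scale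
     (phi_coordinate_topology :: (nat \<Rightarrow>\<^sub>0 'k::real_normed_field) topology)"
proof -
  define B :: "(nat \<Rightarrow>\<^sub>0 'k) set set" where
    "B = {{p. Poly_Mapping.lookup p n \<in> U} | n U. open U}"
  define J where "J = topology_generated_by B"
  have Jphi: "J = phi_coordinate_topology"
    by (simp add: J_def B_def phi_coordinate_topology_def)
  have UB: "UNIV \<in> B"
    unfolding B_def by (intro CollectI exI[of _ 0] exI[of _ UNIV]) auto
  have BU: "\<Union>B = UNIV" using UB by blast
  have top: "topspace J = UNIV" by (simp add: J_def BU)
  have op: "openin J {p. Poly_Mapping.lookup p n \<in> U}" if "open U" for n U
    unfolding J_def B_def using that
    by (intro topology_generated_by_Basis CollectI exI[of _ n] exI[of _ U] conjI refl)
  have coord: "continuous_map J euclidean (\<lambda>p. Poly_Mapping.lookup p n)" for n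
    unfolding continuous_map_def top using op[of _ n]
    by (simp only: UNIV_I simp_thms topspace_euclidean open_openin[symmetric]) simp
  have haus: "Hausdorff_space J"
    unfolding Hausdorff_space_def
  proof (intro allI impI)
    fix p q assume "p \<in> topspace J \<and> q \<in> topspace J \<and> p \<noteq> q"
    then obtain n where "Poly_Mapping.lookup p n \<noteq> Poly_Mapping.lookup q n"
      by (meson poly_mapping_eqI)
    from hausdorff[OF this] obtain U V where UV: "open U" "open V"
      "Poly_Mapping.lookup p n \<in> U" "Poly_Mapping.lookup q n \<in> V" "U \<inter> V = {}" by metis
    have "disjnt {p. Poly_Mapping.lookup p n \<in> U} {p. Poly_Mapping.lookup p n \<in> V}"
      using UV(5) by (auto simp: disjnt_def)
    then show "\<exists>U V. openin J U \<and> openin J V \<and> p \<in> U \<and> q \<in> V \<and> disjnt U V"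
      using op[OF UV(1)] op[OF UV(2)] UV(3,4) by (metis (mono_tags, lifting) mem_Collect_eq)
  qed
  have euc: "continuous_map X euclidean (\<lambda>z. h (f z, g z))"
    if "continuous_on UNIV h" "continuous_map X euclidean f" "continuous_map X euclidean g"
    for X :: "'x topology" and h :: "'k \<times> 'k \<Rightarrow> 'k" and f g
  proof -
    have "continuous_map X (prod_topology euclidean euclidean) (\<lambda>z. (f z, g z))"
      using that by (intro continuous_map_pairedI)
    moreover have "continuous_map (prod_topology euclidean euclidean) euclidean h"
      using that(1) by (simp add: euclidean_product_topology)
    ultimately have "continuous_map X euclidean (h \<circ> (\<lambda>z. (f z, g z)))"
      by (rule continuous_map_compose)
    then show ?thesis by (simp add: o_def)
  qed
  have gen: "continuous_map X J F"
    if F: "\<And>n. continuous_map X euclidean (\<lambda>z. Poly_Mapping.lookup (F z) n)"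
    for X :: "'x topology" and F
    unfolding J_def
  proof (rule continuous_on_generated_topo)
    fix W assume "W \<in> B"
    then obtain n U where W: "W = {p. Poly_Mapping.lookup p n \<in> U}" "open U"
      by (auto simp: B_def)
    have "F -` W \<inter> topspace X = {z \<in> topspace X. Poly_Mapping.lookup (F z) n \<in> U}"
      using W(1) by auto
    then show "openin X (F -` W \<inter> topspace X)"
      using openin_continuous_map_preimage[OF F, of U n] W(2) by simp
  qed (simp add: BU)
  have add: "continuous_map (prod_topology J J) J (\<lambda>(x, y). x + y)"
  proof (rule gen)
    fix n
    have "continuous_map (prod_topology J J) euclidean
        (\<lambda>z. (\<lambda>w. fst w + snd w) (Poly_Mapping.lookup (fst z) n, Poly_Mapping.lookup (snd z) n))"
      by (intro euc continuous_intros
          continuous_map_compose[OF continuous_map_fst coord, unfolded o_def]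
          continuous_map_compose[OF continuous_map_snd coord, unfolded o_def])
    then show "continuous_map (prod_topology J J) euclidean
        (\<lambda>z. Poly_Mapping.lookup (case z of (x, y) \<Rightarrow> x + y) n)"
      by (simp add: case_prod_unfold lookup_add)
  qed
  have scl: "continuous_map (prod_topology euclidean J) J (\<lambda>(c, x). phi_scale c x)"
  proof (rule gen)
    fix n
    have "continuous_map (prod_topology euclidean J) euclidean
        (\<lambda>z. (\<lambda>w. fst w * snd w) (fst z, Poly_Mapping.lookup (snd z) n))"
      by (intro euc continuous_intros continuous_map_fst
          continuous_map_compose[OF continuous_map_snd coord, unfolded o_def])
    then show "continuous_map (prod_topology euclidean J) euclidean
        (\<lambda>z. Poly_Mapping.lookup (case z of (c, x) \<Rightarrow> phi_scale c x) n)"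
      by (simp add: case_prod_unfold phi_scale_lookup)
  qed
  have base: "\<exists>C V. convex_wrt phi_scale C \<and> openin J V \<and> p \<in> V \<and> V \<subseteq> C \<and> C \<subseteq> W"
    if "W \<in> B" "p \<in> W" for W p
  proof -
    from that obtain n U where W: "W = {p. Poly_Mapping.lookup p n \<in> U}" "open U"
      by (auto simp: B_def)
    with that(2) obtain e where e: "e > 0" "ball (Poly_Mapping.lookup p n) e \<subseteq> U"
      by (metis mem_Collect_eq open_contains_ball)
    define C where "C = {q. Poly_Mapping.lookup q n \<in> ball (Poly_Mapping.lookup p n) e}"
    have "convex_wrt phi_scale C"
      unfolding convex_wrt_def
    proof (intro ballI allI impI)
      fix x y and u v :: real
      assume *: "x \<in> C" "y \<in> C" "u \<ge> 0" "v \<ge> 0" "u + v = 1"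
      then have "u *\<^sub>R Poly_Mapping.lookup x n + v *\<^sub>R Poly_Mapping.lookup y n
          \<in> ball (Poly_Mapping.lookup p n) e"
        unfolding C_def
        by (intro convexD[OF convex_ball]) auto
      then show "phi_scale (of_real u) x + phi_scale (of_real v) y \<in> C"
        by (simp add: C_def lookup_add phi_scale_lookup scaleR_conv_of_real)
    qed
    moreover have "openin J C" unfolding C_def by (rule op) simp
    ultimately show ?thesis
      using e W(1) by (intro exI[of _ C] conjI) (auto simp: C_def)
  qed
  have "\<exists>C V. convex_wrt phi_scale C \<and> openin J V \<and> 0 \<in> V \<and> V \<subseteq> C \<and> C \<subseteq> U"
    if "openin J U" "0 \<in> U" for U
    using generated_convex_base[of B phi_scale U 0] base that unfolding J_def by blast
  with haus add scl top vector_space_phi show ?thesis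
    by (auto simp: locally_convex_tvs_def tvs_def simp flip: Jphi)
qed

theorem phi_topology_strongest_locally_convex:
  shows "locally_convex_tvs phi_scale phi_topology"
    and "locally_convex_tvs phi_scale T \<Longrightarrow> openin T U \<Longrightarrow> openin phi_topology U"
  unfolding phi_topology_def
  using strongest_lc_topology_locally_convex[OF phi_coordinate_locally_convex]
    openin_strongest_lc_topology by blast+

end

theory Submission
  imports Defs
begin

text \<open>
  Since \<open>\<phi>\<close> carries the strongest vector space topology, every continuous linear map from \<open>X\<close> with
  infinite-dimensional range in \<open>\<phi>\<close> yields a quotient \<open>\<phi>\<close> of \<open>X\<close>; hence all such maps have finite
  rank. If \<open>z\<close> is cyclic for \<open>T\<close>, let \<open>\<Phi> p = p(T) z\<close> for polynomials \<open>p\<close>, and let \<open>L\<close> be the set of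
  those \<open>p\<close> for which \<open>\<Phi> p\<close> lies in \<open>X \<times> 0\<close>. Finite rank of \<open>x \<mapsto> snd (T (x, 0))\<close> means that \<open>tL\<close>
  is contained in \<open>L\<close> up to finite dimension, so that, up to finitely many exceptions, the set of
  degrees of \<open>L\<close> is closed under successors. As \<open>L\<close> has infinite codimension, its degrees are
  bounded. A dense subspace of \<open>X \<times> \<phi>\<close> that meets \<open>X \<times> 0\<close> in a finite-dimensional space is the
  whole space; applied to the range of \<open>T \<circ> \<Phi>\<close>, which is dense because \<open>T\<close> has dense range, this
  gives \<open>\<Phi> 1 = \<Phi> (t q)\<close> for some \<open>q\<close>, so all multiples of \<open>1 - t q\<close> lie in \<open>L\<close>, a contradiction.
\<close>

section \<open>Continuity in topological vector spaces\<close>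

lemma tvs_topspace: "tvs s T \<Longrightarrow> topspace T = UNIV"
  by (simp add: tvs_def)

lemma continuous_map_tvs_add:
  assumes "tvs s T" "continuous_map Z T f" "continuous_map Z T g"
  shows "continuous_map Z T (\<lambda>z. f z + g z)"
proof -
  have "continuous_map Z T ((\<lambda>(x, y). x + y) \<circ> (\<lambda>z. (f z, g z)))"
    using assms by (intro continuous_map_compose[where X' = "prod_topology T T"])
      (auto simp: tvs_def intro: continuous_map_pairedI)
  then show ?thesis by (simp add: o_def)
qed

lemma continuous_map_tvs_scale:
  assumes "tvs s T" "continuous_map Z euclidean c" "continuous_map Z T f"
  shows "continuous_map Z T (\<lambda>z. s (c z) (f z))"
proof -
  have "continuous_map Z T ((\<lambda>(c, x). s c x) \<circ> (\<lambda>z. (c z, f z)))"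
    using assms by (intro continuous_map_compose[where X' = "prod_topology euclidean T"])
      (auto simp: tvs_def intro: continuous_map_pairedI)
  then show ?thesis by (simp add: o_def)
qed

lemma continuous_map_tvs_diff:
  assumes "tvs s T" "continuous_map Z T f" "continuous_map Z T g"
  shows "continuous_map Z T (\<lambda>z. f z - g z)"
proof -
  interpret vector_space s using assms by (simp add: tvs_def)
  have "continuous_map Z T (\<lambda>z. f z + s (- 1) (g z))"
    by (rule continuous_map_tvs_add[OF assms(1,2) continuous_map_tvs_scale[OF assms(1) _ assms(3)]])
      simp
  then show ?thesis by simp
qed

lemma tvs_add_nhds:
  assumes "tvs s T" "openin T U" "x + y \<in> U"
  obtains V W where "openin T V" "openin T W" "x \<in> V" "y \<in> W"
    "\<And>a b. a \<in> V \<Longrightarrow> b \<in> W \<Longrightarrow> a + b \<in> U"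
proof -
  have "continuous_map (prod_topology T T) T (\<lambda>(x, y). x + y)"
    using assms(1) by (simp add: tvs_def)
  from openin_continuous_map_preimage[OF this assms(2)]
  have "openin (prod_topology T T) {z. fst z + snd z \<in> U}"
    using assms(1) by (simp add: tvs_def case_prod_unfold)
  from this[unfolded openin_prod_topology_alt, rule_format, of x y] assms(3)
  obtain V W where VW: "openin T V" "openin T W" "x \<in> V" "y \<in> W"
    "V \<times> W \<subseteq> {z. fst z + snd z \<in> U}"
    by (metis (no_types, lifting) fst_conv snd_conv mem_Collect_eq)
  show thesis
  proof (rule that[OF VW(1-4)])
    fix a b assume "a \<in> V" "b \<in> W"
    then have "(a, b) \<in> {z. fst z + snd z \<in> U}" using VW(5) by blast
    then show "a + b \<in> U" by simp
  qed
qed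

lemma tvs_scale_nhds:
  assumes "tvs s T" "openin T U" "s c x \<in> U"
  obtains e V where "e > 0" "openin T V" "x \<in> V"
    "\<And>a y. norm (a - c) < e \<Longrightarrow> y \<in> V \<Longrightarrow> s a y \<in> U"
proof -
  have "continuous_map (prod_topology euclidean T) T (\<lambda>(c, x). s c x)"
    using assms(1) by (simp add: tvs_def)
  from openin_continuous_map_preimage[OF this assms(2)]
  have "openin (prod_topology euclidean T) {z. s (fst z) (snd z) \<in> U}"
    using assms(1) by (simp add: tvs_def case_prod_unfold)
  from this[unfolded openin_prod_topology_alt, rule_format, of c x] assms(3)
  obtain A V where A: "open A" "openin T V" "c \<in> A" "x \<in> V"
      "A \<times> V \<subseteq> {z. s (fst z) (snd z) \<in> U}"
    by (metis (no_types, lifting) fst_conv snd_conv mem_Collect_eq open_openin)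
  then obtain e where e: "e > 0" "ball c e \<subseteq> A" by (meson open_contains_ball)
  show thesis
  proof (rule that[OF e(1) A(2,4)])
    fix a y assume "norm (a - c) < e" "y \<in> V"
    then have "a \<in> A" using e(2) by (auto simp: dist_norm norm_minus_commute)
    with \<open>y \<in> V\<close> A(5) have "(a, y) \<in> {z. s (fst z) (snd z) \<in> U}" by blast
    then show "s a y \<in> U" by simp
  qed
qed

text \<open>Translations preserve open sets, so for a linear map continuity at 0 spreads to every
  point.\<close>

lemma continuous_map_linearI:
  assumes T: "tvs s T" and T': "tvs s' T'" and f: "Vector_Spaces.linear s s' f"
    and nhd: "\<And>U. openin T' U \<Longrightarrow> 0 \<in> U \<Longrightarrow> \<exists>V. openin T V \<and> 0 \<in> V \<and> f ` V \<subseteq> U"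
  shows "continuous_map T T' f"
proof -
  interpret Vector_Spaces.linear s s' f by fact
  have "openin T {x. f x \<in> W}" if W: "openin T' W" for W
  proof (subst openin_subopen, clarify)
    fix x assume x: "f x \<in> W"
    have "openin T' {u. f x + u \<in> W}" by (rule tvs_translation[OF T' W])
    from nhd[OF this] x obtain V where V: "openin T V" "0 \<in> V" "f ` V \<subseteq> {u. f x + u \<in> W}"
      by auto
    have "openin T {y. - x + y \<in> V}" by (rule tvs_translation[OF T V(1)])
    moreover have "f y \<in> W" if "- x + y \<in> V" for y
    proof -
      have "f x + f (- x + y) \<in> W" using that V(3) by auto
      moreover have "f x + f (- x + y) = f (x + (- x + y))" by (rule add[symmetric])
      ultimately show ?thesis by (simp only: add_minus_cancel)
    qed
    ultimately show "\<exists>S. openin T S \<and> x \<in> S \<and> S \<subseteq> {x. f x \<in> W}"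
      using V(2) by (intro exI[of _ "{y. - x + y \<in> V}"]) auto
  qed
  then show ?thesis
    using tvs_topspace[OF T] tvs_topspace[OF T'] by (simp add: continuous_map_def)
qed

section \<open>Linear maps on \<open>\<phi>\<close>\<close>

text \<open>Makes every norm topology a competitor in the join \<open>strongest_lc_topology\<close>,
  so that open unit balls are open in the join. The norm is a plain function \<open>N\<close>
  because the scalar multiplication is explicit.\<close>

lemma norm_topology_locally_convex:
  fixes s :: "'k::real_normed_field \<Rightarrow> 'v::ab_group_add \<Rightarrow> 'v" and N :: "'v \<Rightarrow> real"
  assumes "vector_space s"
    and add: "\<And>x y. N (x + y) \<le> N x + N y"
    and scl: "\<And>c x. N (s c x) = norm c * N x"
    and pos: "\<And>x. N x \<ge> 0" and N0: "\<And>x. N x = 0 \<Longrightarrow> x = 0"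
  shows "\<exists>T. locally_convex_tvs s T \<and> openin T {x. N x < 1}"
proof -
  interpret vector_space s by fact
  have zero: "N 0 = 0" using scl[of 0 0] by simp
  have minus: "N (- x) = N x" for x using scl[of "- 1" x] by simp
  have comm: "N (x - y) = N (y - x)" for x y using minus[of "x - y"] by simp
  have tri: "N (x - z) \<le> N (x - y) + N (y - z)" for x y z using add[of "x - y" "y - z"] by simp
  interpret M: Metric_space UNIV "\<lambda>x y. N (x - y)"
  proof
    show "N (x - y) = 0 \<longleftrightarrow> x = y" for x y using N0[of "x - y"] zero by auto
    show "N (x - z) \<le> N (x - y) + N (y - z)" for x y z by (rule tri)
  qed (rule pos comm)+
  let ?T = M.mtopology
  have ball: "M.mball x r = {y. N (x - y) < r}" for x r by (auto simp: M.mball_def)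
  have op: "openin ?T {y. N (x - y) < r}" for x r using M.openin_mball[of x r] by (simp add: ball)
  have "{x. N x < 1} = {x. N (0 - x) < 1}" using minus by simp
  then have unit: "openin ?T {x. N x < 1}" using op by metis
  have plus: "continuous_map (prod_topology ?T ?T) ?T (\<lambda>(x, y). x + y)"
    unfolding continuous_map_def
  proof (intro conjI allI impI)
    fix U assume U: "openin ?T U"
    have "\<exists>V W. openin ?T V \<and> openin ?T W \<and> x \<in> V \<and> y \<in> W \<and> V \<times> W \<subseteq> {z. fst z + snd z \<in> U}"
      if "x + y \<in> U" for x y
    proof -
      from U that obtain r where r: "r > 0" "\<And>z. N (x + y - z) < r \<Longrightarrow> z \<in> U"
        by (auto simp: M.openin_mtopology ball subset_iff)
      have "a + b \<in> U" if "N (x - a) < r / 2" "N (y - b) < r / 2" for a b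
        using add[of "x - a" "y - b"] that by (intro r(2)) (simp add: algebra_simps)
      then show ?thesis
        using r(1) zero op[of x "r / 2"] op[of y "r / 2"]
        by (intro exI[of _ "{a. N (x - a) < r / 2}"] exI[of _ "{b. N (y - b) < r / 2}"]) auto
    qed
    then show "openin (prod_topology ?T ?T)
        {z \<in> topspace (prod_topology ?T ?T). (case z of (x, y) \<Rightarrow> x + y) \<in> U}"
      unfolding openin_prod_topology_alt by (simp add: case_prod_unfold)
  qed auto
  have scale: "continuous_map (prod_topology euclidean ?T) ?T (\<lambda>(c, x). s c x)"
    unfolding continuous_map_def
  proof (intro conjI allI impI)
    fix U assume U: "openin ?T U"
    have "\<exists>V W. open V \<and> openin ?T W \<and> c \<in> V \<and> x \<in> W \<and> V \<times> W \<subseteq> {z. s (fst z) (snd z) \<in> U}"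
      if "s c x \<in> U" for c x
    proof -
      from U that obtain r where r: "r > 0" "\<And>z. N (s c x - z) < r \<Longrightarrow> z \<in> U"
        by (auto simp: M.openin_mtopology ball subset_iff)
      \<comment> \<open>The error splits as (c - a) x + a (x - y), and each summand may cost r / 2.
        The 1 added to \<open>N x\<close> avoids division by zero; the cap \<open>e \<le> 1\<close>
        gives \<open>norm a \<le> norm c + 1\<close>, which explains \<open>d\<close>.\<close>
      define e where "e = min 1 (r / (2 * (N x + 1)))"
      define d where "d = r / 2 / (norm c + 1)"
      have e: "e > 0" "e \<le> 1" "e * N x \<le> r / 2"
      proof -
        show "e > 0" "e \<le> 1" using r(1) pos[of x] by (auto simp: e_def)
        have "e * N x \<le> r / (2 * (N x + 1)) * N x"
          using pos[of x] by (intro mult_right_mono) (auto simp: e_def)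
        also have "\<dots> = r / 2 * (N x / (N x + 1))" by simp
        also have "\<dots> \<le> r / 2 * 1"
          using pos[of x] r(1) by (intro mult_left_mono) auto
        finally show "e * N x \<le> r / 2" by simp
      qed
      have c: "norm c + 1 > 0" by (simp add: add_nonneg_pos)
      then have d: "d > 0" "(norm c + 1) * d = r / 2"
        using r(1) nonzero_mult_div_cancel_left[of "norm c + 1" "r / 2"] by (auto simp: d_def)
      have "s a y \<in> U" if "norm (c - a) < e" "N (x - y) < d" for a y
      proof (rule r(2))
        have "s c x - s a y = s (c - a) x + s a (x - y)"
          by (simp add: scale_left_diff_distrib scale_right_diff_distrib)
        then have "N (s c x - s a y) \<le> norm (c - a) * N x + norm a * N (x - y)"
          using add scl by metis
        also have "norm (c - a) * N x \<le> e * N x"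
          using that pos by (intro mult_right_mono) auto
        also have "norm a * N (x - y) \<le> (norm c + 1) * N (x - y)"
        proof (rule mult_right_mono)
          have "norm a \<le> norm c + norm (c - a)"
            by (metis norm_minus_commute norm_triangle_sub)
          then show "norm a \<le> norm c + 1" using that e by simp
        qed (rule pos)
        also have "(norm c + 1) * N (x - y) < (norm c + 1) * d"
          using that c by (intro mult_strict_left_mono) auto
        finally show "N (s c x - s a y) < r" using e d by simp
      qed
      then show ?thesis
        using e(1) d(1) zero
        by (intro exI[of _ "ball c e"] exI[of _ "{y. N (x - y) < d}"])
          (auto simp: op dist_norm)
    qed
    then show "openin (prod_topology euclidean ?T)
        {z \<in> topspace (prod_topology euclidean ?T). (case z of (c, x) \<Rightarrow> s c x) \<in> U}"
      unfolding openin_prod_topology_alt by (simp add: case_prod_unfold)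
  qed auto
  have conv: "convex_wrt s {y. N (0 - y) < r}" for r
    unfolding convex_wrt_def
  proof (intro ballI allI impI)
    fix x y and u v :: real
    assume *: "x \<in> {y. N (0 - y) < r}" "y \<in> {y. N (0 - y) < r}" "u \<ge> 0" "v \<ge> 0" "u + v = 1"
    have "N (s (of_real u) x + s (of_real v) y) \<le> u * N x + v * N y"
      using add[of "s (of_real u) x" "s (of_real v) y"] * by (simp add: scl)
    also have "\<dots> < r"
      using convex_bound_lt[of "N x" r "N y" u v] * minus by simp
    finally show "s (of_real u) x + s (of_real v) y \<in> {y. N (0 - y) < r}" using minus by simp
  qed
  have "locally_convex_tvs s ?T"
    unfolding locally_convex_tvs_def tvs_def
  proof (intro conjI allI impI)
    fix U assume "openin ?T U \<and> 0 \<in> U"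
    then obtain r where "r > 0" "{y. N (0 - y) < r} \<subseteq> U"
      by (auto simp: M.openin_mtopology ball)
    then show "\<exists>C V. convex_wrt s C \<and> openin ?T V \<and> 0 \<in> V \<and> V \<subseteq> C \<and> C \<subseteq> U"
      using conv[of r] op[of 0 r] zero
      by (intro exI[of _ "{y. N (0 - y) < r}"] conjI) (assumption | simp)+
  next
    show "vector_space s" by fact
  qed (use plus scale M.Hausdorff_space_mtopology in simp_all)
  with unit show ?thesis by blast
qed

lemma tvs_phi: "tvs phi_scale (phi_topology :: (nat \<Rightarrow>\<^sub>0 'k::real_normed_field) topology)"
  using phi_topology_strongest_locally_convex(1) unfolding locally_convex_tvs_def by blast

text \<open>The unit ball of the l1 norm with weights \<open>1 / d n\<close> is such a
  \<open>V\<close>, because the topology of \<phi> refines every norm topology. The sides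
  \<open>d n\<close> may shrink at any rate, which is what makes all linear maps on \<phi>
  continuous.\<close>

lemma openin_phi_weighted_ball:
  fixes d :: "nat \<Rightarrow> real"
  assumes d: "\<And>n. d n > 0"
  shows "\<exists>V :: (nat \<Rightarrow>\<^sub>0 'k::real_normed_field) set. openin phi_topology V \<and> 0 \<in> V \<and>
    (\<forall>p\<in>V. \<forall>n. norm (Poly_Mapping.lookup p n) < d n)"
proof -
  define N :: "(nat \<Rightarrow>\<^sub>0 'k) \<Rightarrow> real"
    where "N p = (\<Sum>n\<in>Poly_Mapping.keys p. norm (Poly_Mapping.lookup p n) / d n)" for p
  \<comment> \<open>Summing over any larger finite index set lets \<open>p\<close>, \<open>q\<close>
    and \<open>p + q\<close> be compared on a common one.\<close>
  have Neq: "N p = (\<Sum>n\<in>A. norm (Poly_Mapping.lookup p n) / d n)"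
    if "finite A" "Poly_Mapping.keys p \<subseteq> A" for p A
    unfolding N_def using that by (intro sum.mono_neutral_left) (auto simp: in_keys_iff)
  have ge: "norm (Poly_Mapping.lookup p n) / d n \<le> N p" for p n
  proof -
    have "norm (Poly_Mapping.lookup p n) / d n
        \<le> (\<Sum>n\<in>insert n (Poly_Mapping.keys p). norm (Poly_Mapping.lookup p n) / d n)"
      using d by (intro member_le_sum) (auto intro!: divide_nonneg_pos)
    then show ?thesis using Neq[of "insert n (Poly_Mapping.keys p)" p] by (simp add: subset_insertI)
  qed
  have add: "N (p + q) \<le> N p + N q" for p q
  proof -
    let ?A = "Poly_Mapping.keys p \<union> Poly_Mapping.keys q"
    have "N (p + q) = (\<Sum>n\<in>?A. norm (Poly_Mapping.lookup p n + Poly_Mapping.lookup q n) / d n)"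
      using Neq[of ?A "p + q"] Poly_Mapping.keys_add[of p q] by (simp add: lookup_add)
    also have "\<dots> \<le> (\<Sum>n\<in>?A. norm (Poly_Mapping.lookup p n) / d n
        + norm (Poly_Mapping.lookup q n) / d n)"
      unfolding add_divide_distrib[symmetric]
      using d by (intro sum_mono divide_right_mono norm_triangle_ineq less_imp_le)
    also have "\<dots> = N p + N q" using Neq[of ?A p] Neq[of ?A q] by (simp add: sum.distrib)
    finally show ?thesis .
  qed
  have scl: "N (phi_scale c p) = norm c * N p" for c p
  proof -
    have "Poly_Mapping.keys (phi_scale c p) \<subseteq> Poly_Mapping.keys p"
      by (auto simp: in_keys_iff phi_scale_lookup)
    from Neq[OF _ this] show ?thesis
      by (simp add: N_def phi_scale_lookup norm_mult sum_distrib_left)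
  qed
  have pos: "N p \<ge> 0" for p
    unfolding N_def using d by (intro sum_nonneg) (auto intro!: divide_nonneg_pos)
  have N0: "p = 0" if "N p = 0" for p
  proof (rule poly_mapping_eqI)
    fix n
    have "norm (Poly_Mapping.lookup p n) / d n \<le> 0" using ge[of p n] that by simp
    then show "Poly_Mapping.lookup p n = Poly_Mapping.lookup 0 n"
      using d[of n] by (simp add: divide_le_0_iff)
  qed
  from norm_topology_locally_convex[OF vector_space_phi add scl pos N0]
  have "openin phi_topology {p. N p < 1}"
    using phi_topology_strongest_locally_convex(2) by blast
  moreover have "norm (Poly_Mapping.lookup p n) < d n" if "N p < 1" for p n
    using ge[of p n] that d[of n] by (simp add: divide_le_eq) (smt (verit) mult_less_cancel_right2)
  moreover have "N 0 = 0" by (simp add: N_def)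
  ultimately show ?thesis by (intro exI[of _ "{p. N p < 1}"]) auto
qed

lemma phi_expansion:
  fixes p :: "nat \<Rightarrow>\<^sub>0 'k::real_normed_field"
  obtains n where "p = (\<Sum>i<n. phi_scale (Poly_Mapping.lookup p i) (Poly_Mapping.single i 1))"
proof -
  obtain n where n: "\<forall>i\<in>Poly_Mapping.keys p. i < n"
    using finite_nat_set_iff_bounded finite_keys by metis
  have "p = (\<Sum>i<n. phi_scale (Poly_Mapping.lookup p i) (Poly_Mapping.single i 1))"
  proof (rule poly_mapping_eqI)
    fix m
    have "(\<Sum>i<n. Poly_Mapping.lookup p i * (1 when i = m)) = (Poly_Mapping.lookup p m when m < n)"
      by (simp add: when_def if_distrib cong: if_cong)
    also have "\<dots> = Poly_Mapping.lookup p m" using n by (auto simp: when_def in_keys_iff)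
    finally show "Poly_Mapping.lookup p m = Poly_Mapping.lookup
        (\<Sum>i<n. phi_scale (Poly_Mapping.lookup p i) (Poly_Mapping.single i 1)) m"
      by (simp add: lookup_sum phi_scale_lookup lookup_single)
  qed
  then show thesis by (rule that)
qed

text \<open>As the dimension of \<open>\<phi>\<close> is countable, its strongest locally convex topology is even the
  strongest of all vector space topologies.\<close>

theorem continuous_map_phi:
  fixes s :: "'k::real_normed_field \<Rightarrow> 'a::ab_group_add \<Rightarrow> 'a"
  assumes T: "tvs s T" and f: "Vector_Spaces.linear phi_scale s f"
  shows "continuous_map phi_topology T f"
proof (rule continuous_map_linearI[OF tvs_phi T f])
  interpret Vector_Spaces.linear phi_scale s f by fact
  fix U assume U: "openin T U" "0 \<in> U"
  have half: "\<exists>W. (openin T W \<and> 0 \<in> W) \<and> (\<forall>a\<in>W. \<forall>b\<in>W. a + b \<in> V)"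
    if V: "openin T V \<and> 0 \<in> V" for V
  proof -
    from V tvs_add_nhds[OF T, of V 0 0] obtain A B where
      "openin T A" "openin T B" "0 \<in> A" "0 \<in> B" "\<And>a b. a \<in> A \<Longrightarrow> b \<in> B \<Longrightarrow> a + b \<in> V"
      by auto
    then show ?thesis by (intro exI[of _ "A \<inter> B"]) auto
  qed
  \<comment> \<open>Repeated halving gives neighbourhoods of 0 in which two elements of
    \<open>W (Suc n)\<close> add up to an element of \<open>W n\<close>; this chain replaces
    convexity in the target. The clause for \<open>n = 0\<close> anchors it at
    \<open>U\<close>.\<close>
  have "\<exists>W. \<forall>n. ((openin T (W n) \<and> 0 \<in> W n) \<and> (n = 0 \<longrightarrow> W n = U)) \<and>
      (\<forall>a\<in>W (Suc n). \<forall>b\<in>W (Suc n). a + b \<in> W n)"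
    by (rule dependent_nat_choice) (use U half in auto)
  then obtain W where "W 0 = U" and W: "\<And>n. openin T (W n) \<and> 0 \<in> W n"
    and WS: "\<And>n. \<forall>a\<in>W (Suc n). \<forall>b\<in>W (Suc n). a + b \<in> W n"
    by blast
  \<comment> \<open>The coordinate with index n only has to be so small that its own term lands in
    \<open>W (Suc n)\<close>. These thresholds become the sides of the weighted box.\<close>
  have "\<exists>d>0. \<forall>c. norm c < d \<longrightarrow> s c (f (Poly_Mapping.single n 1)) \<in> W (Suc n)" for n
  proof -
    have "openin T (W (Suc n))" "s 0 (f (Poly_Mapping.single n 1)) \<in> W (Suc n)"
      using W by auto
    then obtain e V where "e > 0" "openin T V" "f (Poly_Mapping.single n 1) \<in> V"
      "\<And>a y. norm (a - 0) < e \<Longrightarrow> y \<in> V \<Longrightarrow> s a y \<in> W (Suc n)"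
      by (rule tvs_scale_nhds[OF T]) blast
    then show ?thesis by auto
  qed
  then obtain d where d: "\<And>n. d n > 0"
    "\<And>n c. norm c < d n \<Longrightarrow> s c (f (Poly_Mapping.single n 1)) \<in> W (Suc n)" by metis
  \<comment> \<open>Absorbing the terms from the last to the first keeps every sum that starts at m
    inside \<open>W m\<close>, whatever its length.\<close>
  have sums: "(\<Sum>i=m..<m + k. a i) \<in> W m" if "\<And>i. a i \<in> W (Suc i)" for m k a
  proof (induction k arbitrary: m)
    case (Suc k)
    have "a m + (\<Sum>i=Suc m..<Suc m + k. a i) \<in> W m" using WS that Suc.IH by blast
    moreover have "(\<Sum>i=m..<m + Suc k. a i) = a m + (\<Sum>i=Suc m..<Suc m + k. a i)"
      by (subst sum.atLeast_Suc_lessThan) simp_all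
    ultimately show ?case by simp
  qed (use W in simp)
  obtain V :: "(nat \<Rightarrow>\<^sub>0 'k) set" where V: "openin phi_topology V" "0 \<in> V"
    "\<And>p n. p \<in> V \<Longrightarrow> norm (Poly_Mapping.lookup p n) < d n"
    using openin_phi_weighted_ball[of d] d(1) by blast
  have "f p \<in> U" if "p \<in> V" for p
  proof -
    obtain n where "p = (\<Sum>i<n. phi_scale (Poly_Mapping.lookup p i) (Poly_Mapping.single i 1))"
      by (rule phi_expansion)
    then have "f p = f (\<Sum>i<n. phi_scale (Poly_Mapping.lookup p i) (Poly_Mapping.single i 1))"
      by (rule arg_cong)
    also have "\<dots> = (\<Sum>i=0..<0 + n. s (Poly_Mapping.lookup p i) (f (Poly_Mapping.single i 1)))"
      by (simp add: sum scale atLeast0LessThan)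
    also have "\<dots> \<in> W 0" using d(2) V(3) that by (intro sums) blast
    finally show ?thesis by (simp add: \<open>W 0 = U\<close>)
  qed
  with V show "\<exists>V. openin phi_topology V \<and> 0 \<in> V \<and> f ` V \<subseteq> U" by blast
qed

section \<open>Dimension and subspaces of \<phi>\<close>

interpretation phi: vector_space "phi_scale :: 'k::real_normed_field \<Rightarrow> _"
  by (rule vector_space_phi)

lemma phi_independent_units:
  "phi.independent (range (\<lambda>n. Poly_Mapping.single n (1 :: 'k::real_normed_field)))"
proof -
  have "Poly_Mapping.single n (1 :: 'k)
      \<notin> phi.span (range (\<lambda>n. Poly_Mapping.single n 1) - {Poly_Mapping.single n 1})" for n
  proof -
    have "phi.span (range (\<lambda>n. Poly_Mapping.single n 1) - {Poly_Mapping.single n (1 :: 'k)})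
        \<subseteq> {p. Poly_Mapping.lookup p n = 0}"
      by (intro phi.span_minimal)
        (auto simp: phi.subspace_def lookup_add phi_scale_lookup lookup_single when_def)
    then show ?thesis by (auto simp: lookup_single)
  qed
  then show ?thesis by (auto simp: phi.dependent_def)
qed

lemma phi_not_finite_dimensional:
  assumes "finite F"
  shows "phi.span F \<noteq> (UNIV :: (nat \<Rightarrow>\<^sub>0 'k::real_normed_field) set)"
proof
  assume "phi.span F = UNIV"
  then have "range (\<lambda>n. Poly_Mapping.single n (1 :: 'k)) \<subseteq> phi.span F" by simp
  from phi.independent_span_bound[OF assms phi_independent_units this]
  have "finite (range (\<lambda>n :: nat. Poly_Mapping.single n (1 :: 'k)))" ..
  moreover have "inj (\<lambda>n :: nat. Poly_Mapping.single n (1 :: 'k))"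
    by (auto simp: inj_def dest!: arg_cong[where f = Poly_Mapping.keys])
  ultimately show False using finite_imageD infinite_UNIV_nat by blast
qed

text \<open>A linear projection onto \<open>W\<close> is automatically continuous on \<phi>, and
  \<open>W\<close> is its set of fixed points, which is closed in a Hausdorff space.\<close>

lemma closedin_phi_subspace:
  assumes "phi.subspace (W :: (nat \<Rightarrow>\<^sub>0 'k::real_normed_field) set)"
  shows "closedin phi_topology W"
proof -
  interpret vector_space_pair "phi_scale :: 'k \<Rightarrow> _" "phi_scale :: 'k \<Rightarrow> _" by unfold_locales
  obtain g :: "(nat \<Rightarrow>\<^sub>0 'k) \<Rightarrow> _" where g: "range g \<subseteq> W" "Vector_Spaces.linear phi_scale phi_scale g"
    "\<And>w. w \<in> W \<Longrightarrow> g w = w"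
    using linear_exists_left_inverse_on[OF phi.linear_ident assms] by auto
  have "continuous_map phi_topology phi_topology g"
    by (rule continuous_map_phi[OF tvs_phi g(2)])
  moreover have "Hausdorff_space (phi_topology :: (nat \<Rightarrow>\<^sub>0 'k) topology)"
    using tvs_phi unfolding tvs_def by blast
  ultimately have "closedin phi_topology {x \<in> topspace phi_topology. g x = x}"
    by (intro closedin_continuous_maps_eq[where f = g]) auto
  moreover have "x \<in> W" if "g x = x" for x
    using subsetD[OF g(1) rangeI[of g x]] that by simp
  then have "{x \<in> topspace phi_topology. g x = x} = W"
    unfolding tvs_topspace[OF tvs_phi] using g(3) by auto
  ultimately show ?thesis by simp
qed

section \<open>Continuous linear maps into \<open>\<phi>\<close>\<close>

lemma coset_of_eq_iff:
  assumes "vector_space s" "module.subspace s Y"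
  shows "coset_of Y x = coset_of Y y \<longleftrightarrow> x - y \<in> Y"
proof -
  interpret vector_space s by fact
  show ?thesis
  proof
    assume "coset_of Y x = coset_of Y y"
    moreover have "x + 0 \<in> coset_of Y x"
      unfolding coset_of_def by (rule imageI) (rule subspace_0[OF assms(2)])
    ultimately obtain w where "w \<in> Y" "x = y + w" by (auto simp: coset_of_def)
    then show "x - y \<in> Y" by simp
  next
    have sub: "coset_of Y u \<subseteq> coset_of Y v" if "u - v \<in> Y" for u v
    proof
      fix z assume "z \<in> coset_of Y u"
      then obtain w where "w \<in> Y" "z = v + ((u - v) + w)" by (auto simp: coset_of_def)
      then show "z \<in> coset_of Y v"
        unfolding coset_of_def using that subspace_add[OF assms(2)] by blast
    qed
    assume "x - y \<in> Y"
    moreover from this have "y - x \<in> Y" using subspace_neg[OF assms(2), of "x - y"] by simp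
    ultimately show "coset_of Y x = coset_of Y y" using sub by blast
  qed
qed

text \<open>A linear right inverse of \<open>g\<close> is automatically continuous, being defined on
  \<phi>. So \<open>g\<close> is a retraction, hence a quotient map, and the bijection it induces on
  the cosets of its kernel is a homeomorphism.\<close>

lemma has_quotient_phi_if_surj:
  fixes s :: "'k::real_normed_field \<Rightarrow> 'a::ab_group_add \<Rightarrow> 'a" and g :: "'a \<Rightarrow> nat \<Rightarrow>\<^sub>0 'k"
  assumes X: "tvs s X" and g: "Vector_Spaces.linear s phi_scale g"
    and cont: "continuous_map X phi_topology g" and surj: "surj g"
  shows "has_quotient_isomorphic s X (phi_scale :: 'k \<Rightarrow> _) phi_topology"
proof -
  interpret g: Vector_Spaces.linear s "phi_scale :: 'k \<Rightarrow> _" g by fact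
  interpret vector_space_pair s "phi_scale :: 'k \<Rightarrow> _" by unfold_locales
  obtain r where r: "Vector_Spaces.linear phi_scale s r" "g \<circ> r = id"
    using linear_surjective_right_inverse[OF g surj] by auto
  have "continuous_map phi_topology X r" by (rule continuous_map_phi[OF X r(1)])
  then have "quotient_map X phi_topology g"
    using cont r(2) by (intro retraction_imp_quotient_map)
      (auto simp: retraction_map_def retraction_maps_def fun_eq_iff)
  define Y where "Y = {x. g x = 0}"
  have Y: "g.vs1.subspace Y" unfolding Y_def using g.subspace_kernel .
  have clo: "closedin X Y"
  proof -
    have "closedin phi_topology {0 :: nat \<Rightarrow>\<^sub>0 'k}" by (rule closedin_phi_subspace) simp
    from closedin_continuous_map_preimage[OF cont this] show ?thesis
      using tvs_topspace[OF X] by (simp add: Y_def)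
  qed
  have same: "coset_of Y x = coset_of Y y \<longleftrightarrow> g x = g y" for x y
    using coset_of_eq_iff[OF g.vs1.vector_space_axioms Y] by (simp add: Y_def g.diff)
  \<comment> \<open>\<open>f\<close> evaluates \<open>g\<close> at a chosen representative; by
    \<open>same\<close> the choice is immaterial.\<close>
  define f where "f A = g (SOME x. A = coset_of Y x)" for A
  have f: "f (coset_of Y x) = g x" for x
  proof -
    have "coset_of Y x = coset_of Y (SOME y. coset_of Y x = coset_of Y y)"
      by (rule someI) (rule refl)
    then show ?thesis unfolding f_def same by simp
  qed
  have fg: "f \<circ> coset_of Y = g" by (simp add: fun_eq_iff f)
  note q = quotient_map_coset_of[of X Y]
  have "continuous_map (quotient_topology X Y) phi_topology f"
    using continuous_compose_quotient_map_eq[OF q] cont fg by metis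
  then have "quotient_map (quotient_topology X Y) phi_topology f"
    using quotient_map_from_composition[OF quotient_imp_continuous_map[OF q]]
      \<open>quotient_map X phi_topology g\<close> fg by metis
  moreover have "inj_on f (topspace (quotient_topology X Y))"
  proof -
    have "topspace (quotient_topology X Y) = range (coset_of Y)"
      using q tvs_topspace[OF X] by (simp add: quotient_map_def)
    then show ?thesis by (auto simp: inj_on_def f same)
  qed
  ultimately have "homeomorphic_map (quotient_topology X Y) phi_topology f"
    by (simp add: homeomorphic_map_def)
  then have "quotient_isomorphic s X Y phi_scale phi_topology"
    unfolding quotient_isomorphic_def
    by (intro exI[of _ f])
      (auto simp: f g.add g.scale quotient_operations[OF g.vs1.vector_space_axioms Y])
  with Y clo show ?thesis by (auto simp: has_quotient_isomorphic_def)
qed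

text \<open>If the range were infinite-dimensional, a linear and hence continuous map
  \<open>h\<close> of \<phi> into itself could send an independent sequence in it to the unit
  vectors. Then \<open>h \<circ> f\<close> would be a continuous surjection onto \<phi>, and its
  kernel would give a quotient isomorphic to \<phi>.\<close>

lemma finite_rank_if_no_quotient_phi:
  fixes s :: "'k::real_normed_field \<Rightarrow> 'a::ab_group_add \<Rightarrow> 'a" and f :: "'a \<Rightarrow> nat \<Rightarrow>\<^sub>0 'k"
  assumes X: "tvs s X" and f: "Vector_Spaces.linear s phi_scale f"
    and cont: "continuous_map X phi_topology f"
    and no: "\<not> has_quotient_isomorphic s X (phi_scale :: 'k \<Rightarrow> _) phi_topology"
  shows "\<exists>F. finite F \<and> range f \<subseteq> phi.span F"
proof (rule ccontr)
  assume *: "\<not> ?thesis"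
  interpret f: Vector_Spaces.linear s "phi_scale :: 'k \<Rightarrow> _" f by fact
  interpret vector_space_pair "phi_scale :: 'k \<Rightarrow> _" "phi_scale :: 'k \<Rightarrow> _" by unfold_locales
  obtain B where B: "B \<subseteq> range f" "phi.independent B" "range f \<subseteq> phi.span B"
    by (rule phi.basis_exists)
  with * have "infinite B" by blast
  then obtain b :: "nat \<Rightarrow> _" where b: "inj b" "range b \<subseteq> B"
    using infinite_countable_subset by blast
  \<comment> \<open>On basis vectors outside \<open>range b\<close> the index \<open>inv b x\<close>
    is arbitrary. This is harmless, since only surjectivity of \<open>h \<circ> f\<close>
    matters.\<close>
  obtain h where h: "Vector_Spaces.linear phi_scale phi_scale h"
    "\<And>x. x \<in> B \<Longrightarrow> h x = Poly_Mapping.single (inv b x) (1 :: 'k)"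
    using linear_independent_extend[OF B(2), of "\<lambda>x. Poly_Mapping.single (inv b x) 1"] by blast
  interpret h: Vector_Spaces.linear "phi_scale :: 'k \<Rightarrow> _" "phi_scale :: 'k \<Rightarrow> _" h by fact
  have lin: "Vector_Spaces.linear s phi_scale (h \<circ> f)"
    by (rule Vector_Spaces.linear_compose[OF f h(1)])
  interpret hf: Vector_Spaces.linear s "phi_scale :: 'k \<Rightarrow> _" "h \<circ> f" by (rule lin)
  have units: "Poly_Mapping.single n (1 :: 'k) \<in> range (h \<circ> f)" for n
  proof -
    have "b n \<in> B" using b(2) by auto
    moreover from this obtain x where "b n = f x" using B(1) by auto
    ultimately have "(h \<circ> f) x = Poly_Mapping.single n 1" using h(2)[of "b n"] inv_f_f[OF b(1), of n]
      by simp
    then show ?thesis by (metis rangeI)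
  qed
  have "surj (h \<circ> f)"
  proof -
    have "p \<in> range (h \<circ> f)" for p
    proof -
      obtain n where "p = (\<Sum>i<n. phi_scale (Poly_Mapping.lookup p i) (Poly_Mapping.single i 1))"
        by (rule phi_expansion)
      moreover have "phi.subspace (range (h \<circ> f))" by (rule hf.subspace_image) simp
      ultimately show ?thesis
        using units by (metis (no_types, lifting) phi.subspace_sum phi.subspace_scale)
    qed
    then show ?thesis by blast
  qed
  moreover have "continuous_map X phi_topology (h \<circ> f)"
    using cont continuous_map_phi[OF tvs_phi h(1)] by (rule continuous_map_compose)
  ultimately show False using has_quotient_phi_if_surj[OF X lin] no by blast
qed

section \<open>Finite-dimensional subspaces\<close>

text \<open>If \<open>v\<close> lies outside \<open>M\<close>, the sums with bounded coefficient of
  \<open>v\<close> form a closed set, and near any given point the coefficients are bounded.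
  Iterating this from {0} yields closedness of finite-dimensional subspaces.\<close>

lemma closedin_add_line:
  fixes s :: "'k::{real_normed_field, euclidean_space} \<Rightarrow> 'a::ab_group_add \<Rightarrow> 'a"
  assumes X: "tvs s X" and M: "module.subspace s M" "closedin X M"
  shows "closedin X {m + s c v | m c. m \<in> M}"
proof -
  interpret vector_space s using X by (simp add: tvs_def)
  have top: "topspace X = UNIV" by (rule tvs_topspace[OF X])
  show ?thesis
  proof (cases "v \<in> M")
    case True
    have "{m + s c v | m c. m \<in> M} = M"
    proof safe
      show "m + s c v \<in> M" if "m \<in> M" for m c
        using that True subspace_add[OF M(1)] subspace_scale[OF M(1)] by blast
      show "\<exists>m' c. m = m' + s c v \<and> m' \<in> M" if "m \<in> M" for m
        using that by (intro exI[of _ m] exI[of _ 0]) simp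
    qed
    with M(2) show ?thesis by simp
  next
    case False
    let ?S = "{m + s c v | m c. m \<in> M}"
    let ?K = "\<lambda>r. {m + s c v | m c. m \<in> M \<and> norm c \<le> r}"
    have K: "closedin X (?K r)" for r :: real
    proof -
      define Y where "Y = subtopology euclidean (cball (0 :: 'k) r)"
      \<comment> \<open>Projection along a compact factor is a closed map; compactness of balls in
        the ground field enters here.\<close>
      have "compact_space Y" by (simp add: Y_def compact_space_subtopology)
      from Abstract_Topological_Spaces.closed_map_fst[OF this]
      have fst: "closed_map (prod_topology X Y) X fst" .
      have "continuous_map (prod_topology X Y) X (\<lambda>z. fst z - s (snd z) v)"
        by (intro continuous_map_tvs_diff[OF X] continuous_map_tvs_scale[OF X] continuous_map_fst)
          (auto simp: Y_def top intro: continuous_map_into_fulltopology[OF continuous_map_snd])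
      from closedin_continuous_map_preimage[OF this M(2)]
      have "closedin X (fst ` {z \<in> topspace (prod_topology X Y). fst z - s (snd z) v \<in> M})"
        using fst by (simp add: closed_map_def)
      also have "fst ` {z \<in> topspace (prod_topology X Y). fst z - s (snd z) v \<in> M} = ?K r"
      proof safe
        fix x c assume "(x, c) \<in> topspace (prod_topology X Y)" "fst (x, c) - s (snd (x, c)) v \<in> M"
        then show "\<exists>m c'. fst (x, c) = m + s c' v \<and> m \<in> M \<and> norm c' \<le> r"
          by (intro exI[of _ "x - s c v"] exI[of _ c]) (simp add: Y_def)
      next
        fix m and c :: 'k assume "m \<in> M" "norm c \<le> r"
        then show "m + s c v \<in> fst ` {z \<in> topspace (prod_topology X Y). fst z - s (snd z) v \<in> M}"
          by (intro image_eqI[of _ _ "(m + s c v, c)"]) (simp_all add: Y_def top)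
      qed
      finally show ?thesis .
    qed
    have "x \<in> ?S" if x: "x \<in> X closure_of ?S" for x
    proof -
      \<comment> \<open>\<open>U\<close> is an open neighbourhood of 0. If y = m + c v is close to x
        and c is large, then y / c lies in \<open>U\<close>, whereas v - y / c = - m / c lies in
        \<open>M\<close>. This bounds c by \<open>1 / e\<close> on \<open>V\<close>.\<close>
      define U where "U = {u. v - u \<notin> M}"
      have "closedin X {u \<in> topspace X. v - u \<in> M}"
        by (rule closedin_continuous_map_preimage[OF continuous_map_tvs_diff[OF X] M(2)])
          (simp_all add: top)
      moreover have "U = topspace X - {u \<in> topspace X. v - u \<in> M}" by (auto simp: U_def top)
      ultimately have U: "openin X U" by (simp add: closedin_def)
      have "s 0 x \<in> U" using False by (simp add: U_def)
      then obtain e V where e: "e > 0" and V: "openin X V" "x \<in> V"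
        "\<And>a y. norm (a - 0) < e \<Longrightarrow> y \<in> V \<Longrightarrow> s a y \<in> U"
        by (rule tvs_scale_nhds[OF X U]) blast
      have "?S \<inter> V \<subseteq> ?K (1 / e)"
      proof
        fix y assume "y \<in> ?S \<inter> V"
        then obtain m c where y: "y = m + s c v" "m \<in> M" "y \<in> V" by blast
        have "norm c \<le> 1 / e"
        proof (rule ccontr)
          assume c: "\<not> norm c \<le> 1 / e"
          then have "0 < norm c" "1 / e < norm c"
            using e by (auto intro: order.strict_trans[of 0 "1 / e"])
          then have "norm (1 / c - 0) < e"
            using e by (simp add: norm_divide divide_less_eq mult.commute)
          from V(3)[OF this y(3)] have "v - s (1 / c) y \<notin> M" by (simp add: U_def)
          moreover have "c \<noteq> 0" using c e by auto
          then have "v - s (1 / c) y = s (- (1 / c)) m"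
            by (simp add: y(1) scale_right_distrib)
          ultimately show False using subspace_scale[OF M(1) y(2), of "- (1 / c)"] by simp
        qed
        with y show "y \<in> ?K (1 / e)" by blast
      qed
      then have "X closure_of (V \<inter> ?S) \<subseteq> ?K (1 / e)"
        using K by (intro closure_of_minimal) (simp_all only: Int_commute)
      moreover have "x \<in> X closure_of (V \<inter> ?S)"
        using openin_Int_closure_of_subset[OF V(1), of ?S] x V(2) by blast
      ultimately show ?thesis by blast
    qed
    then have "X closure_of ?S \<subseteq> ?S" by blast
    then show ?thesis using closure_of_subset_eq[of ?S X] by (simp add: top)
  qed
qed

lemma closedin_finite_span:
  fixes s :: "'k::{real_normed_field, euclidean_space} \<Rightarrow> 'a::ab_group_add \<Rightarrow> 'a"
  assumes X: "tvs s X" and "finite F"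
  shows "closedin X (module.span s F)"
  using assms(2)
proof induction
  interpret vector_space s using X by (simp add: tvs_def)
  case empty
  have "closedin X {0}"
    using X by (intro closedin_Hausdorff_singleton) (auto simp: tvs_def)
  then show ?case by simp
next
  interpret vector_space s using X by (simp add: tvs_def)
  case (insert v F)
  have "span (insert v F) = {m + s c v | m c. m \<in> span F}"
  proof (intro set_eqI iffI)
    fix x assume "x \<in> span (insert v F)"
    then obtain c where "x - s c v \<in> span F" by (auto simp: span_insert)
    then show "x \<in> {m + s c v | m c. m \<in> span F}"
      by (intro CollectI exI[of _ "x - s c v"] exI[of _ c]) simp
  next
    fix x assume "x \<in> {m + s c v | m c. m \<in> span F}"
    then obtain m c where "x = m + s c v" "m \<in> span F" by blast
    then show "x \<in> span (insert v F)"
      by (auto simp: span_insert intro!: exI[of _ c])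
  qed
  with closedin_add_line[OF X subspace_span insert.IH] show ?case by simp
qed

text \<open>The projection of \<open>S\<close> to \<phi> is dense and, as a subspace of \<phi>,
  closed, so it is all of \<phi>. It has a linear section with values in \<open>S\<close>,
  automatically continuous, and this reduces the claim to the fibre of \<open>S\<close> over 0,
  which is closed because it is finite-dimensional.\<close>

lemma dense_subspace_eq_UNIV:
  fixes s :: "'k::{real_normed_field, euclidean_space} \<Rightarrow> 'a::ab_group_add \<Rightarrow> 'a"
    and S :: "('a \<times> (nat \<Rightarrow>\<^sub>0 'k)) set"
  assumes X: "tvs s X" and S: "module.subspace (prod_scale s phi_scale) S"
    and dense: "dense_in (prod_topology X phi_topology) S"
    and F: "finite F" "{x. (x, 0) \<in> S} \<subseteq> module.span s F"
  shows "S = UNIV"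
proof -
  let ?E = "prod_topology X phi_topology" and ?sE = "prod_scale s phi_scale"
  interpret s: vector_space s using X by (simp add: tvs_def)
  interpret E: vector_space ?sE
    by (rule vector_space_prod_scale[OF s.vector_space_axioms vector_space_phi])
  interpret vector_space_pair ?sE "phi_scale :: 'k \<Rightarrow> _" by unfold_locales
  have closure: "?E closure_of S = UNIV"
    using dense by (simp add: dense_in_def tvs_topspace[OF X] tvs_topspace[OF tvs_phi])
  have snd: "Vector_Spaces.linear ?sE phi_scale snd"
    by unfold_locales (auto simp: prod_scale_def)
  have fst: "Vector_Spaces.linear ?sE s fst"
    by unfold_locales (auto simp: prod_scale_def)
  have "phi.subspace (snd ` S)" by (rule linear_subspace_image[OF snd S])
  then have "phi_topology closure_of (snd ` S) = snd ` S"
    by (intro closure_of_closedin closedin_phi_subspace)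
  with continuous_map_image_closure_subset[OF continuous_map_snd, of X phi_topology S]
  have "snd ` UNIV \<subseteq> snd ` S" by (simp add: closure)
  then have "phi.span UNIV \<subseteq> snd ` E.span S" by (simp add: E.span_eq_iff[THEN iffD2, OF S])
  from linear_surj_right_inverse[OF snd this] E.span_eq_iff[THEN iffD2, OF S]
  obtain g where g: "range g \<subseteq> S" "Vector_Spaces.linear phi_scale ?sE g" "\<And>u. snd (g u) = u"
    by auto
  define \<sigma> where "\<sigma> = fst \<circ> g"
  have \<sigma>: "Vector_Spaces.linear phi_scale s \<sigma>"
    unfolding \<sigma>_def by (rule Vector_Spaces.linear_compose[OF g(2) fst])
  have geq: "g u = (\<sigma> u, u)" for u by (simp add: \<sigma>_def g(3) prod_eq_iff)
  have gS: "(\<sigma> u, u) \<in> S" for u using g(1) geq by (metis rangeI subsetD)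
  \<comment> \<open>\<open>(R z, 0)\<close> is \<open>z\<close> minus the value of the section at
    \<open>snd z\<close>. So \<open>R\<close> maps \<open>S\<close> into the fibre over 0, and by
    continuity and density it maps the whole space there.\<close>
  define R where "R z = fst z - \<sigma> (snd z)" for z
  have R: "continuous_map ?E X R"
    unfolding R_def using continuous_map_compose[OF continuous_map_snd continuous_map_phi[OF X \<sigma>]]
    by (intro continuous_map_tvs_diff[OF X] continuous_map_fst) (simp add: o_def)
  define M where "M = {x. (x, 0) \<in> S}"
  have "s.subspace M"
    using E.subspace_0[OF S] E.subspace_add[OF S] E.subspace_scale[OF S]
    by (fastforce simp: s.subspace_def M_def prod_scale_def zero_prod_def)
  \<comment> \<open>Closedness is known for finite spans, while \<open>F\<close> only spans a space
    containing \<open>M\<close>; hence a basis of \<open>M\<close> itself.\<close>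
  moreover obtain B where B: "B \<subseteq> M" "s.independent B" "M \<subseteq> s.span B" by (rule s.basis_exists)
  ultimately have "M = s.span B" using s.span_minimal by blast
  moreover have "finite B"
    using s.independent_span_bound[OF F(1) B(2)] B(1) F(2) by (auto simp: M_def)
  ultimately have M: "closedin X M" using closedin_finite_span[OF X] by simp
  have RS: "(R z, 0) \<in> S" if "z \<in> S" for z
    using E.subspace_diff[OF S that gS[of "snd z"]] by (cases z) (simp add: R_def)
  have "range R \<subseteq> X closure_of (R ` S)"
    using continuous_map_image_closure_subset[OF R, of S] by (simp add: closure)
  also have "\<dots> \<subseteq> M" using RS M by (intro closure_of_minimal) (auto simp: M_def)
  finally have RM: "(R z, 0) \<in> S" for z by (auto simp: M_def)
  have "z \<in> S" for z
    using E.subspace_add[OF S RM[of z] gS[of "snd z"]] by (simp add: R_def)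
  then show ?thesis by blast
qed

section \<open>Linear maps on polynomials\<close>

interpretation poly: vector_space "smult :: 'k::field \<Rightarrow> 'k poly \<Rightarrow> 'k poly"
  by unfold_locales (auto simp: smult_add_right smult_add_left)

text \<open>Vectors that each avoid the span of their predecessors are independent, so the dimension
  of the span of \<open>F\<close> bounds their number.\<close>

lemma (in vector_space) finite_if_triangular:
  fixes f :: "nat \<Rightarrow> 'b" and A :: "nat set"
  assumes tri: "\<And>d. d \<in> A \<Longrightarrow> f d \<notin> span (f ` {e \<in> A. e < d})"
    and F: "finite F" "f ` A \<subseteq> span F"
  shows "finite A"
proof (rule ccontr)
  assume "infinite A"
  then obtain B where B: "finite B" "card B = Suc (card F)" "B \<subseteq> A"
    using infinite_arbitrarily_large by blast
  have "C \<subseteq> A \<longrightarrow> independent (f ` C) \<and> card (f ` C) = card C" if "finite C" for C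
    using that
  proof (induction rule: finite_linorder_max_induct)
    case (insert b C)
    have "f b \<notin> span (f ` C)" if "insert b C \<subseteq> A"
    proof -
      have "f ` C \<subseteq> f ` {e \<in> A. e < b}" using that insert.hyps by auto
      then show ?thesis using tri[of b] that span_mono by blast
    qed
    moreover from this have "f b \<notin> f ` C" if "insert b C \<subseteq> A" using that span_base by blast
    ultimately show ?case
      using insert by (auto simp: independent_insert card_insert_if)
  qed (simp add: independent_empty)
  with B have "independent (f ` B)" "card (f ` B) = Suc (card F)" by auto
  moreover have "f ` B \<subseteq> span F" using B(3) F(2) by blast
  ultimately show False using independent_span_bound[OF F(1)] by fastforce
qed

lemma poly_in_span_monom:
  fixes p :: "'k::field poly"
  assumes "\<And>i. i \<ge> n \<Longrightarrow> coeff p i = 0"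
  shows "p \<in> poly.span ((\<lambda>i. monom 1 i) ` {..<n})"
proof -
  have "p = (\<Sum>i<n. smult (coeff p i) (monom 1 i))"
    by (rule poly_eqI) (auto simp: coeff_sum if_distrib assms cong: if_cong)
  also have "\<dots> \<in> poly.span ((\<lambda>i. monom 1 i) ` {..<n})"
    by (intro poly.span_sum poly.span_scale poly.span_base) auto
  finally show ?thesis .
qed

text \<open>Let t be the indeterminate, so that \<open>pCons 0 p\<close> is t p. Consider degrees d
  attained in the kernel of \<psi> for which d + 1 is not attained. The vectors \<psi> (t p), with
  one p of each such degree d, are triangular and lie in the span of \<open>F\<close>, so there are
  finitely many such d. If the degrees were unbounded, all large ones would occur, and reduction by
  kernel elements would make the range of \<psi> finite-dimensional.\<close>

lemma kernel_bounded_degree: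
  fixes \<psi> :: "'k::field poly \<Rightarrow> 'b::ab_group_add"
  assumes \<psi>: "Vector_Spaces.linear smult s \<psi>"
    and F: "finite F" "\<And>p. \<psi> p = 0 \<Longrightarrow> \<psi> (pCons 0 p) \<in> module.span s F"
    and inf: "\<And>G. finite G \<Longrightarrow> \<not> range \<psi> \<subseteq> module.span s G"
  shows "\<exists>n. \<forall>p. \<psi> p = 0 \<longrightarrow> (\<forall>i\<ge>n. coeff p i = 0)"
proof -
  interpret \<psi>: Vector_Spaces.linear smult s \<psi> by fact
  define h where "h p = \<psi> (pCons 0 p)" for p
  interpret h: Vector_Spaces.linear smult s h
  proof
    fix p q :: "'k poly" and c
    have "pCons 0 (p + q) = pCons 0 p + pCons 0 q" by simp
    then show "h (p + q) = h p + h q" unfolding h_def by (simp only: \<psi>.add)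
    have "pCons 0 (smult c p) = smult c (pCons 0 p)" by simp
    then show "h (smult c p) = s c (h p)" unfolding h_def by (simp only: \<psi>.scale)
  qed
  define D where "D = {d. \<exists>p. p \<noteq> 0 \<and> \<psi> p = 0 \<and> degree p = d}"
  then have "\<forall>d\<in>D. \<exists>p. p \<noteq> 0 \<and> \<psi> p = 0 \<and> degree p = d" by simp
  then obtain P where P: "\<And>d. d \<in> D \<Longrightarrow> P d \<noteq> 0 \<and> \<psi> (P d) = 0 \<and> degree (P d) = d"
    by (auto dest!: bchoice)
  define A where "A = {d \<in> D. Suc d \<notin> D}"
  have "finite A"
  proof (rule \<psi>.vs2.finite_if_triangular[OF _ F(1), of _ "\<lambda>d. h (P d)"])
    show "(\<lambda>d. h (P d)) ` A \<subseteq> \<psi>.vs2.span F"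
      using P F(2) by (auto simp: A_def h_def)
  next
    fix d assume d: "d \<in> A"
    show "h (P d) \<notin> \<psi>.vs2.span ((\<lambda>d. h (P d)) ` {e \<in> A. e < d})"
    proof
      assume "h (P d) \<in> \<psi>.vs2.span ((\<lambda>d. h (P d)) ` {e \<in> A. e < d})"
      also have "(\<lambda>d. h (P d)) ` {e \<in> A. e < d} = h ` P ` {e \<in> A. e < d}" by auto
      also have "\<psi>.vs2.span (h ` P ` {e \<in> A. e < d}) = h ` poly.span (P ` {e \<in> A. e < d})"
        by (rule h.span_image)
      finally obtain q where q: "q \<in> poly.span (P ` {e \<in> A. e < d})" "h (P d) = h q" by auto
      \<comment> \<open>Members of this span lie in the kernel and have no coefficients from
        \<open>d\<close> on, so \<open>P d - q\<close> still has degree d. As \<open>h\<close>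
        vanishes on it, its product with t is a kernel element of degree d + 1.\<close>
      have "poly.span (P ` {e \<in> A. e < d}) \<subseteq> {q. \<psi> q = 0 \<and> (\<forall>i\<ge>d. coeff q i = 0)}"
        using P by (intro poly.span_minimal)
          (auto simp: poly.subspace_def \<psi>.add \<psi>.scale \<psi>.zero A_def intro!: coeff_eq_0)
      with q have q': "\<psi> q = 0" "\<And>i. i \<ge> d \<Longrightarrow> coeff q i = 0" by auto
      have Pd: "P d \<noteq> 0" "\<psi> (P d) = 0" "degree (P d) = d" using P d by (auto simp: A_def)
      define r where "r = P d - q"
      have "coeff (P d) d \<noteq> 0" using Pd by (metis leading_coeff_0_iff)
      then have "coeff r d \<noteq> 0" using q'(2)[of d] by (simp add: r_def)
      moreover have "degree r \<le> d" using Pd q' by (intro degree_le) (simp add: r_def coeff_eq_0)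
      ultimately have "degree r = d" "r \<noteq> 0" by (auto simp: le_antisym le_degree)
      moreover have "\<psi> (pCons 0 r) = 0" using q(2) by (simp add: r_def h.diff flip: h_def)
      ultimately have "Suc d \<in> D" by (auto simp: D_def intro!: exI[of _ "pCons 0 r"])
      with d show False by (simp add: A_def)
    qed
  qed
  have "finite D"
  proof (rule ccontr)
    assume "infinite D"
    from \<open>finite A\<close> obtain m where m: "\<And>d. d \<in> A \<Longrightarrow> d < m"
      by (meson finite_nat_set_iff_bounded)
    \<comment> \<open>\<open>n\<close> exceeds every element of \<open>A\<close>, so from
      \<open>n\<close> on membership in \<open>D\<close> passes to successors.\<close>
    from \<open>infinite D\<close> obtain n where n: "n \<ge> m" "n \<in> D" by (meson infinite_nat_iff_unbounded_le)
    have nD: "d \<in> D" if "d \<ge> n" for d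
      using that
    proof (induction rule: dec_induct)
      case (step d)
      then show ?case using m[of d] n(1) by (fastforce simp: A_def)
    qed (rule n(2))
    define G where "G = \<psi> ` (\<lambda>i. monom 1 i) ` {..<n}"
    have low: "\<psi> p \<in> \<psi>.vs2.span G" if "\<And>i. i \<ge> n \<Longrightarrow> coeff p i = 0" for p
      using poly_in_span_monom[OF that] unfolding G_def \<psi>.span_image by blast
    \<comment> \<open>Subtracting a multiple of the kernel element of degree n + k removes the top
      coefficient without changing the value of \<psi>.\<close>
    have *: "\<forall>p. (\<forall>i\<ge>n + k. coeff p i = 0) \<longrightarrow> \<psi> p \<in> \<psi>.vs2.span G" for k
    proof (induction k)
      case (Suc k)
      show ?case
      proof (intro allI impI)
        fix p :: "'k poly" assume p: "\<forall>i\<ge>n + Suc k. coeff p i = 0"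
        have nk: "P (n + k) \<noteq> 0" "\<psi> (P (n + k)) = 0" "degree (P (n + k)) = n + k"
          using P nD by auto
        define q where "q = p - smult (coeff p (n + k) / coeff (P (n + k)) (n + k)) (P (n + k))"
        have "coeff q i = 0" if "i \<ge> n + k" for i
        proof (cases "i = n + k")
          case True
          have "coeff (P (n + k)) (n + k) \<noteq> 0" using nk by (metis leading_coeff_0_iff)
          then show ?thesis by (simp add: q_def True)
        next
          case False
          then show ?thesis using that p nk by (simp add: q_def coeff_eq_0)
        qed
        with Suc.IH have "\<psi> q \<in> \<psi>.vs2.span G" by blast
        moreover have "\<psi> q = \<psi> p" by (simp add: q_def \<psi>.diff \<psi>.scale nk)
        ultimately show "\<psi> p \<in> \<psi>.vs2.span G" by simp
      qed
    qed (use low in auto)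
    have "\<psi> p \<in> \<psi>.vs2.span G" for p
    proof -
      have "coeff p i = 0" if "i \<ge> n + Suc (degree p)" for i
        using that by (intro coeff_eq_0) simp
      with * show ?thesis by blast
    qed
    then have "range \<psi> \<subseteq> \<psi>.vs2.span G" by blast
    moreover have "finite G" by (simp add: G_def)
    ultimately show False using inf by blast
  qed
  then obtain n where n: "\<And>d. d \<in> D \<Longrightarrow> d < n" by (meson finite_nat_set_iff_bounded)
  have "coeff p i = 0" if "\<psi> p = 0" "i \<ge> n" for p i
  proof (cases "p = 0")
    case False
    then have "degree p < n" using n that by (auto simp: D_def)
    with that show ?thesis by (simp add: coeff_eq_0)
  qed simp
  then show ?thesis by blast
qed

text \<open>\<Phi> is evaluation p(T) z. It turns multiplication by the indeterminate into
  \<open>T\<close>, so questions about the orbit become questions about degrees.\<close>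

lemma poly_orbit_map:
  fixes s :: "'k::field \<Rightarrow> 'b::ab_group_add \<Rightarrow> 'b"
  assumes T: "Vector_Spaces.linear s s T"
  obtains \<Phi> where "Vector_Spaces.linear smult s \<Phi>" "\<And>p. \<Phi> (pCons 0 p) = T (\<Phi> p)"
    "module.span s (range (\<lambda>n. (T ^^ n) z)) \<subseteq> range \<Phi>"
proof -
  interpret T: Vector_Spaces.linear s s T by fact
  define \<Phi> where "\<Phi> p = (\<Sum>i<Suc (degree p). s (coeff p i) ((T ^^ i) z))" for p
  \<comment> \<open>Any range past the degree gives the same sum, so polynomials of different
    degrees can be added termwise.\<close>
  have \<Phi>: "\<Phi> p = (\<Sum>i<n. s (coeff p i) ((T ^^ i) z))" if "degree p < n" for p n
    unfolding \<Phi>_def using that by (intro sum.mono_neutral_left) (auto simp: coeff_eq_0)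
  have lin: "Vector_Spaces.linear smult s \<Phi>"
  proof
    fix p q :: "'k poly" and c
    let ?n = "Suc (max (degree p) (degree q))"
    have "degree (p + q) < ?n" using degree_add_le_max[of p q] by simp
    then show "\<Phi> (p + q) = \<Phi> p + \<Phi> q"
      using \<Phi>[of p ?n] \<Phi>[of q ?n] \<Phi>[of "p + q" ?n]
      by (simp add: T.vs1.scale_left_distrib sum.distrib del: sum.lessThan_Suc)
    have "degree (smult c p) < Suc (degree p)" using degree_smult_le[of c p] by simp
    then show "\<Phi> (smult c p) = s c (\<Phi> p)"
      using \<Phi>[of "smult c p" "Suc (degree p)"] \<Phi>[of p "Suc (degree p)"]
      by (simp add: T.vs1.scale_sum_right del: sum.lessThan_Suc)
  qed
  have step: "\<Phi> (pCons 0 p) = T (\<Phi> p)" for p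
  proof -
    have "degree (pCons 0 p) < Suc (Suc (degree p))" using degree_pCons_le[of 0 p] by simp
    then have "\<Phi> (pCons 0 p) = (\<Sum>i<Suc (degree p). s (coeff p i) ((T ^^ Suc i) z))"
      by (subst \<Phi>) (auto simp: sum.lessThan_Suc_shift simp del: sum.lessThan_Suc)
    also have "\<dots> = T (\<Phi> p)" by (simp add: \<Phi>_def T.sum T.scale del: sum.lessThan_Suc)
    finally show ?thesis .
  qed
  interpret \<Phi>: Vector_Spaces.linear smult s \<Phi> by (rule lin)
  have "(T ^^ n) z = \<Phi> (monom 1 n)" for n
  proof (induction n)
    case 0
    show ?case by (simp add: \<Phi>_def monom_0)
  next
    case (Suc n)
    then show ?case by (simp add: monom_Suc step)
  qed
  then have "T.vs1.span (range (\<lambda>n. (T ^^ n) z)) \<subseteq> range \<Phi>"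
    by (intro T.vs1.span_minimal \<Phi>.subspace_image) auto
  from that[OF lin step this] show thesis .
qed

section \<open>Cyclic operators with dense range on the product with \<phi>\<close>

theorem theorem1p12:
  fixes smul :: "'k::{real_normed_field, euclidean_space} \<Rightarrow> 'a::ab_group_add \<Rightarrow> 'a"
    and X :: "'a topology"
  assumes "tvs smul X"
    and "\<exists>x::'a. x \<noteq> 0"
    and "\<not> has_quotient_isomorphic smul X
           (phi_scale :: 'k \<Rightarrow> (nat \<Rightarrow>\<^sub>0 'k) \<Rightarrow> (nat \<Rightarrow>\<^sub>0 'k)) phi_topology"
  shows "\<not> (\<exists>T :: 'a \<times> (nat \<Rightarrow>\<^sub>0 'k) \<Rightarrow> 'a \<times> (nat \<Rightarrow>\<^sub>0 'k).
           continuous_operator (prod_scale smul phi_scale) (prod_topology X phi_topology) T \<and>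
           cyclic_operator (prod_scale smul phi_scale) (prod_topology X phi_topology) T \<and>
           dense_in (prod_topology X phi_topology) (range T))"
proof (rule notI, elim exE conjE)
  let ?E = "prod_topology X (phi_topology :: (nat \<Rightarrow>\<^sub>0 'k) topology)"
  let ?sE = "prod_scale smul (phi_scale :: 'k \<Rightarrow> _)"
  fix T :: "'a \<times> (nat \<Rightarrow>\<^sub>0 'k) \<Rightarrow> 'a \<times> (nat \<Rightarrow>\<^sub>0 'k)"
  assume T: "continuous_operator ?sE ?E T" "cyclic_operator ?sE ?E T" "dense_in ?E (range T)"
  note X = assms(1)
  have lin: "Vector_Spaces.linear ?sE ?sE T" and cont: "continuous_map ?E ?E T"
    using T(1) by (auto simp: continuous_operator_def)
  interpret s: vector_space smul using X by (simp add: tvs_def)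
  interpret T: Vector_Spaces.linear ?sE ?sE T by (rule lin)
  have top: "topspace ?E = UNIV" by (simp add: tvs_topspace[OF X] tvs_topspace[OF tvs_phi])
  obtain z where z: "dense_in ?E (T.vs1.span (range (\<lambda>n. (T ^^ n) z)))"
    using T(2) by (auto simp: cyclic_operator_def)
  obtain \<Phi> where \<Phi>: "Vector_Spaces.linear smult ?sE \<Phi>" "\<And>p. \<Phi> (pCons 0 p) = T (\<Phi> p)"
    "T.vs1.span (range (\<lambda>n. (T ^^ n) z)) \<subseteq> range \<Phi>"
    by (rule poly_orbit_map[OF lin, of z]) blast
  interpret \<Phi>: Vector_Spaces.linear smult ?sE \<Phi> by (rule \<Phi>(1))
  have dense: "?E closure_of (range \<Phi>) = UNIV"
    using z closure_of_mono[OF \<Phi>(3), of ?E] unfolding dense_in_def top by blast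
  have snd: "Vector_Spaces.linear ?sE phi_scale snd"
    by unfold_locales (auto simp: prod_scale_def)
  have fst: "Vector_Spaces.linear ?sE smul fst"
    by unfold_locales (auto simp: prod_scale_def)
  have inl: "Vector_Spaces.linear smul ?sE (\<lambda>x. (x, 0))"
    by unfold_locales (auto simp: prod_scale_def)
  define \<psi> where "\<psi> = snd \<circ> \<Phi>"
  have \<psi>: "Vector_Spaces.linear smult phi_scale \<psi>"
    unfolding \<psi>_def by (rule Vector_Spaces.linear_compose[OF \<Phi>(1) snd])
  \<comment> \<open>\<open>C\<close> is the block of \<open>T\<close> leading from the first factor
    to \<phi>; it is the map to which the hypothesis on quotients is applied.\<close>
  define C where "C = snd \<circ> (T \<circ> (\<lambda>x. (x, 0)))"
  have C: "Vector_Spaces.linear smul phi_scale C"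
    unfolding C_def
    by (rule Vector_Spaces.linear_compose[OF Vector_Spaces.linear_compose[OF inl lin] snd])
  have "continuous_map X ?E (\<lambda>x. (x, 0))"
    by (intro continuous_map_pairedI) (auto simp: tvs_topspace[OF tvs_phi])
  then have "continuous_map X phi_topology C"
    unfolding C_def
    by (rule continuous_map_compose[OF continuous_map_compose[OF _ cont] continuous_map_snd])
  from finite_rank_if_no_quotient_phi[OF X C this assms(3)]
  obtain F where F: "finite F" "range C \<subseteq> phi.span F" by blast
  have "\<exists>n. \<forall>p. \<psi> p = 0 \<longrightarrow> (\<forall>i\<ge>n. coeff p i = 0)"
  proof (rule kernel_bounded_degree[OF \<psi> F(1)])
    \<comment> \<open>When \<Phi> p has second component 0, the second component of its image under
      \<open>T\<close> is determined by \<open>C\<close> alone.\<close>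
    fix p assume "\<psi> p = 0"
    then have "\<Phi> p = (fst (\<Phi> p), 0)" by (simp add: \<psi>_def prod_eq_iff)
    then have "\<psi> (pCons 0 p) = C (fst (\<Phi> p))" by (simp add: \<psi>_def C_def \<Phi>(2))
    with F(2) show "\<psi> (pCons 0 p) \<in> phi.span F" by auto
  next
    \<comment> \<open>Subspaces of \<phi> are closed, so if the range of \<psi> lay in the span of
      \<open>G\<close>, density of \<open>range \<Phi>\<close> would force this span to be all of
      \<phi>.\<close>
    fix G :: "(nat \<Rightarrow>\<^sub>0 'k) set" assume G: "finite G"
    show "\<not> range \<psi> \<subseteq> phi.span G"
    proof
      assume "range \<psi> \<subseteq> phi.span G"
      then have "phi_topology closure_of (snd ` range \<Phi>) \<subseteq> phi.span G"
        by (intro closure_of_minimal closedin_phi_subspace) (auto simp: \<psi>_def)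
      with continuous_map_image_closure_subset[OF continuous_map_snd, of X phi_topology "range \<Phi>"]
      have "range snd \<subseteq> phi.span G" by (simp add: dense)
      then have "phi.span G = UNIV" by auto
      with phi_not_finite_dimensional[OF G] show False by blast
    qed
  qed
  then obtain n where n: "\<And>p i. \<psi> p = 0 \<Longrightarrow> i \<ge> n \<Longrightarrow> coeff p i = 0" by blast
  \<comment> \<open>The image of \<open>range \<Phi>\<close> under \<open>T\<close> consists of the
    values of \<Phi> at multiples of t. Those with second component 0 come from polynomials without
    coefficients from \<open>n\<close> on, so the fibre over 0 is finite-dimensional.\<close>
  have "T ` range \<Phi> = UNIV"
  proof (rule dense_subspace_eq_UNIV[OF X])
    show "T.vs1.subspace (T ` range \<Phi>)"
      by (intro T.subspace_image \<Phi>.subspace_image) simp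
    have "range T \<subseteq> ?E closure_of (T ` range \<Phi>)"
      using continuous_map_image_closure_subset[OF cont, of "range \<Phi>"] by (simp add: dense)
    then have "?E closure_of (range T) \<subseteq> ?E closure_of (T ` range \<Phi>)"
      by (intro closure_of_minimal) auto
    then show "dense_in ?E (T ` range \<Phi>)" using T(3) unfolding dense_in_def top by blast
    show "finite ((fst \<circ> \<Phi>) ` (\<lambda>i. monom 1 i) ` {..<n})" by simp
    show "{x. (x, 0) \<in> T ` range \<Phi>} \<subseteq> s.span ((fst \<circ> \<Phi>) ` (\<lambda>i. monom 1 i) ` {..<n})"
    proof
      interpret f: Vector_Spaces.linear smult smul "fst \<circ> \<Phi>"
        by (rule Vector_Spaces.linear_compose[OF \<Phi>(1) fst])
      fix x assume "x \<in> {x. (x, 0) \<in> T ` range \<Phi>}"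
      then obtain p where p: "(x, 0) = \<Phi> (pCons 0 p)" by (auto simp: \<Phi>(2))
      then have "\<psi> (pCons 0 p) = 0" unfolding \<psi>_def o_def by (metis snd_conv)
      then have "pCons 0 p \<in> poly.span ((\<lambda>i. monom 1 i) ` {..<n})"
        using n by (intro poly_in_span_monom)
      moreover have "x = (fst \<circ> \<Phi>) (pCons 0 p)" unfolding o_def by (metis p fst_conv)
      ultimately show "x \<in> s.span ((fst \<circ> \<Phi>) ` (\<lambda>i. monom 1 i) ` {..<n})"
        unfolding f.span_image by blast
    qed
  qed
  then have "\<Phi> 1 \<in> T ` range \<Phi>" by simp
  then obtain q where "\<Phi> 1 = \<Phi> (pCons 0 q)" by (auto simp: \<Phi>(2))
  then have r: "\<Phi> (1 - pCons 0 q) = 0" by (simp add: \<Phi>.diff)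
  \<comment> \<open>Applying \<open>T\<close> shows that all products of 1 - t q with powers of t
    stay in the kernel of \<Phi>. The coefficient of index k in the k-th product is the constant
    term 1 of 1 - t q, which for k = n contradicts the degree bound.\<close>
  have "\<Phi> ((pCons 0 ^^ k) (1 - pCons 0 q)) = 0" for k
  proof (induction k)
    case (Suc k)
    then show ?case by (simp only: funpow.simps o_apply \<Phi>(2)) simp
  qed (simp add: r)
  then have "coeff ((pCons 0 ^^ n) (1 - pCons 0 q)) n = 0" by (intro n) (simp_all add: \<psi>_def)
  moreover have "coeff ((pCons 0 ^^ k) (1 - pCons 0 q)) k = 1" for k
    by (induction k) simp_all
  ultimately show False by simp
qed

end
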